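(* Consider the secure distributed linearly separable computation problem with $\mathsf K_{\rm c}=1$, $\mathsf M=\frac{\mathsf K}{\mathsf N}\mathsf M'$ where $\mathsf M'=\mathsf N-\mathsf N_{\rm r}+1$, and suppose $\frac{\mathsf M'}{\gcd(\mathsf N,\mathsf M')}\le 4$. Then the minimum randomness size among secure schemes achieving the optimal communication cost is $\eta^\star=h(\mathsf N,\mathsf M')-1$, where $h$ is the function defined below.
   Context: Problem setting. $\mathsf K,\mathsf N,\mathsf N_{\rm r}$ are positive integers with $\mathsf N_{\rm r}\le \mathsf N$ and $\mathsf N$ dividing $\mathsf K$. Fix a prime power $\mathsf q$ (sufficiently large) and a positive integer $\mathsf L$. Datasets $D_1,\dots,D_{\mathsf K}$ are independent; message $W_k=f_k(D_k)\in\mathbb F_{\mathsf q}^{\mathsf L}$, with $W_1,\dots,W_{\mathsf K}$ mutually independent and uniform over $\mathbb F_{\mathsf q}^{\mathsf L}$. The user wants $W_1+\cdots+W_{\mathsf K}$. A secure scheme consists of an assignment $\mathcal Z_n\subseteq[\mathsf K]$, $|\mathcal Z_n|\le\mathsf M$; a random variable $Q$ on a finite set independent of the datasets, given to all servers but not the user; transmissions $X_n=\psi_n(\{W_k:k\in\mathcal Z_n\},Q)\in\mathbb F_{\mathsf q}^{\mathsf T_n}$; decodability from $\{X_n:n\in\mathcal A\}$ for every $\mathcal A\subseteq[\mathsf N]$, $|\mathcal A|=\mathsf N_{\rm r}$; security $I(W_1,\dots,W_{\mathsf K};X_1,\dots,X_{\mathsf N}\mid W_1+\cdots+W_{\mathsf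 K})=0$. Communication cost $\mathsf R=\max_{|\mathcal A|=\mathsf N_{\rm r}}\sum_{n\in\mathcal A}\mathsf T_n/\mathsf L$; randomness size $\eta=H(Q)/\mathsf L$ ($\mathsf q$-ary units). $\mathsf R^\star$ is the minimum communication cost over secure schemes and $\eta^\star$ the minimum of $\eta$ over secure schemes with $\mathsf R=\mathsf R^\star$. The function $h$: for integers $1\le m\le n$, define $h(n,m)$ recursively, applying the first applicable rule: (1) if $g=\gcd(n,m)>1$, $h(n,m)=h(n/g,m/g)$; (2) if $m=1$, $h(n,1)=n$; (3) if $n>2m$, $h(n,m)=h\big(n-\lfloor n/m-1\rfloor m,\,m\big)+\lfloor n/m-1\rfloor$; (4) if $1.5m\le n<2m$ and $m$ is even, $h(n,m)=h(n-m,m/2)+1$; (5) if $1.5m\le n<2m$ and $m$ is odd, $h(n,m)=n-\frac{3m-5}{2}$; (6) if $m<n<1.5m$, $h(n,m)=h(m,2m-n)$. *)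

theory Defs
  imports "HOL-Algebra.Ring" "HOL-Probability.Probability_Mass_Function"
begin

text \<open>Recursive definition of h, applying the first applicable rule. Arguments outside
  the domain 1 \<le> m \<le> n are mapped to 0 (never used). The quantity floor(n/m - 1)
  in rule (3) equals n div m - 1 for natural numbers n, m with m > 0.\<close>

function h :: "nat \<Rightarrow> nat \<Rightarrow> nat" where
  "h n m =
    (if m = 0 \<or> n < m then 0
     else if gcd n m > 1 then h (n div gcd n m) (m div gcd n m)
     else if m = 1 then n
     else if n > 2 * m then h (n - (n div m - 1) * m) m + (n div m - 1)
     else if 3 * m \<le> 2 * n \<and> n < 2 * m \<and> even m then h (n - m) (m div 2) + 1
     else if 3 * m \<le> 2 * n \<and> n < 2 * m \<and> odd m then n - (3 * m - 5) div 2
     else if m < n \<and> 2 * n < 3 * m then h m (2 * m - n)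
     else 0)"
  by pat_completeness auto
termination
proof (relation "Wellfounded.measure fst")
  show "wf (Wellfounded.measure fst)" by simp
next
  fix n m :: nat
  assume "\<not> (m = 0 \<or> n < m)" "1 < gcd n m"
  then show "((n div gcd n m, m div gcd n m), n, m) \<in> Wellfounded.measure fst"
    by (simp add: div_less_dividend)
next
  fix n m :: nat
  assume a: "\<not> (m = 0 \<or> n < m)" "n > 2 * m"
  then have "n div m \<ge> 2" by (metis div_le_mono mult.commute nonzero_mult_div_cancel_left less_imp_le)
  then have "(n div m - 1) * m > 0" using a by simp
  moreover have "(n div m - 1) * m \<le> n" using a
  proof -
    have "(n div m - 1) * m \<le> n div m * m" by simp
    also have "\<dots> \<le> n" by simp
    finally show ?thesis .
  qed
  ultimately have "n - (n div m - 1) * m < n" by linarith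
  then show "((n - (n div m - 1) * m, m), n, m) \<in> Wellfounded.measure fst" by simp
next
  fix n m :: nat
  assume "\<not> (m = 0 \<or> n < m)"
  then show "((n - m, m div 2), n, m) \<in> Wellfounded.measure fst" by simp
next
  fix n m :: nat
  assume "m < n \<and> 2 * n < 3 * m"
  then show "((m, 2 * m - n), n, m) \<in> Wellfounded.measure fst" by simp
qed

text \<open>Elements of F_q^L are lists of length L over the carrier of a finite field F.
  Datasets/messages are indexed by 1..K, servers by 1..N.\<close>

definition msgs :: "'a ring \<Rightarrow> nat \<Rightarrow> nat \<Rightarrow> (nat \<Rightarrow> 'a list) set" where
  "msgs F K L = PiE {1..K} (\<lambda>_. {xs. length xs = L \<and> set xs \<subseteq> carrier F})"

definition vsum :: "'a ring \<Rightarrow> nat \<Rightarrow> nat \<Rightarrow> (nat \<Rightarrow> 'a list) \<Rightarrow> 'a list" where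
  "vsum F K L W = map (\<lambda>i. finsum F (\<lambda>k. W k ! i) {1..K}) [0..<L]"

definition ent :: "real \<Rightarrow> 'b pmf \<Rightarrow> real" where
  "ent b P = - (\<Sum>x\<in>set_pmf P. pmf P x * log b (pmf P x))"

definition cmi :: "real \<Rightarrow> 'w pmf \<Rightarrow> ('w \<Rightarrow> 'x) \<Rightarrow> ('w \<Rightarrow> 'y) \<Rightarrow> ('w \<Rightarrow> 'z) \<Rightarrow> real" where
  "cmi b J f g c =
     ent b (map_pmf (\<lambda>w. (f w, c w)) J) + ent b (map_pmf (\<lambda>w. (g w, c w)) J)
     - ent b (map_pmf (\<lambda>w. (f w, g w, c w)) J) - ent b (map_pmf c J)"

text \<open>A secure scheme: assignment Z, distribution P of the common randomness Q
  (on a finite set, encoded in nat), encoding functions psi, transmission lengths T.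
  The joint distribution of (W_1..W_K, Q) is uniform messages times P (independent).\<close>
definition secure_scheme ::
  "'a ring \<Rightarrow> nat \<Rightarrow> nat \<Rightarrow> nat \<Rightarrow> nat \<Rightarrow> nat \<Rightarrow> (nat \<Rightarrow> nat set) \<Rightarrow> nat pmf
     \<Rightarrow> (nat \<Rightarrow> (nat \<Rightarrow> 'a list) \<Rightarrow> nat \<Rightarrow> 'a list) \<Rightarrow> (nat \<Rightarrow> nat) \<Rightarrow> bool" where
  "secure_scheme F K N Nr M L Z P \<psi> T \<longleftrightarrow>
     (\<forall>n\<in>{1..N}. Z n \<subseteq> {1..K} \<and> card (Z n) \<le> M) \<and>
     finite (set_pmf P) \<and>
     (\<forall>n\<in>{1..N}. \<forall>W\<in>msgs F K L. \<forall>W'\<in>msgs F K L. \<forall>Q\<in>set_pmf P.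
        (\<forall>k\<in>Z n. W k = W' k) \<longrightarrow> \<psi> n W Q = \<psi> n W' Q) \<and>
     (\<forall>n\<in>{1..N}. \<forall>W\<in>msgs F K L. \<forall>Q\<in>set_pmf P.
        length (\<psi> n W Q) = T n \<and> set (\<psi> n W Q) \<subseteq> carrier F) \<and>
     (\<forall>A. A \<subseteq> {1..N} \<and> card A = Nr \<longrightarrow>
        (\<exists>dec :: (nat \<Rightarrow> 'a list) \<Rightarrow> 'a list.
           \<forall>W\<in>msgs F K L. \<forall>Q\<in>set_pmf P. dec (\<lambda>n\<in>A. \<psi> n W Q) = vsum F K L W)) \<and>
     cmi (real (card (carrier F))) (pair_pmf (pmf_of_set (msgs F K L)) P)
        fst (\<lambda>(W, Q). (\<lambda>n\<in>{1..N}. \<psi> n W Q)) (\<lambda>(W, Q). vsum F K L W) = 0"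

definition comm_cost :: "nat \<Rightarrow> nat \<Rightarrow> nat \<Rightarrow> (nat \<Rightarrow> nat) \<Rightarrow> real" where
  "comm_cost N Nr L T = real (Max {\<Sum>n\<in>A. T n | A. A \<subseteq> {1..N} \<and> card A = Nr}) / real L"

definition rand_size :: "'a ring \<Rightarrow> nat \<Rightarrow> nat pmf \<Rightarrow> real" where
  "rand_size F L P = ent (real (card (carrier F))) P / real L"

definition comm_optimal_scheme ::
  "'a ring \<Rightarrow> nat \<Rightarrow> nat \<Rightarrow> nat \<Rightarrow> nat \<Rightarrow> nat \<Rightarrow> (nat \<Rightarrow> nat set) \<Rightarrow> nat pmf
     \<Rightarrow> (nat \<Rightarrow> (nat \<Rightarrow> 'a list) \<Rightarrow> nat \<Rightarrow> 'a list) \<Rightarrow> (nat \<Rightarrow> nat) \<Rightarrow> bool" where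
  "comm_optimal_scheme F K N Nr M L Z P \<psi> T \<longleftrightarrow>
     secure_scheme F K N Nr M L Z P \<psi> T \<and>
     (\<forall>Z' P' \<psi>' T'. secure_scheme F K N Nr M L Z' P' \<psi>' T' \<longrightarrow>
        comm_cost N Nr L T \<le> comm_cost N Nr L T')"

end

theory Submission
  imports Defs
begin

text \<open>Converse. Let M' = N - Nr + 1. Decodability from any Nr servers forces every dataset to lie at
  exactly M' servers, and a transmission is an injective function of each message it involves.
  If each server of a list holds a dataset that the earlier ones do not hold, then a transcript has
  probability at most q^(-c L), where c is the length of the list; security then gives
  H(Q) >= (c - 1) L. Double counting yields a list of length at least N / M'. If N / M' is
  larger than c - 1/2 and all lists have length at most c, then two servers hold equal or
  disjoint sets of datasets, which makes M' a divisor of N. For M' / gcd(N, M') <= 4 these two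
  bounds together amount to h(N, M').

  Achievability. Every server sends a linear form in the sum of the messages and h - 1
  combinations masked by uniform noise, which is secure whatever the forms are. The forms are direct
  sums of blocks of M' identical servers with one of finitely many small configurations over a field
  with at least five elements.\<close>

section \<open>Chains of servers in a uniform cover\<close>

text \<open>Encodings are arbitrary functions, so the converse cannot use ranks. Its substitute:
  with everything else fixed, a transmission is injective in each single message. Along a fresh list
  this dependence is triangular, so for fixed \<open>Q\<close> a transcript leaves at most q^(L (K -
  c)) message tuples. Given the sum, the transcript says nothing more about the messages, so its
  remaining entropy, at least (c - 1) L, has to come from \<open>Q\<close>. Let n, m be N, M'
  divided by their gcd. For 2 <= m <= 4 the only residues of n modulo m are 1 and m - 1. For residue
  1, h is n / m rounded up and covering suffices. For residue m - 1 with m = 3 or 4, h is one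
  larger; with c = h - 1 one has n / m = c - 1/m > c - 1/2, so a loss of half a block is already a
  contradiction. Other residues first occur at m = 5. On the constructive side, one more block of m
  servers raises both h and the number of masked combinations by one, so explicit configurations are
  needed only for (n, m) = (1, 1), (m + 1, m), (5, 3) and (7, 4). They use at most five distinct
  field elements, whence the field size.\<close>

fun fresh_chain :: "('i \<Rightarrow> 'd set) \<Rightarrow> 'd set \<Rightarrow> 'i list \<Rightarrow> bool" where
  "fresh_chain Z U [] \<longleftrightarrow> True"
| "fresh_chain Z U (n # ns) \<longleftrightarrow> \<not> Z n \<subseteq> U \<and> fresh_chain Z (U \<union> Z n) ns"

lemma fresh_chain_append:
  "fresh_chain Z U (xs @ ys) \<longleftrightarrow> fresh_chain Z U xs \<and> fresh_chain Z (U \<union> \<Union>(Z ` set xs)) ys"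
  by (induction xs arbitrary: U) (auto simp: Un_assoc)

lemma fresh_chain_mono: "fresh_chain Z U xs \<Longrightarrow> U' \<subseteq> U \<Longrightarrow> fresh_chain Z U' xs"
proof (induction xs arbitrary: U U')
  case (Cons x xs)
  have "fresh_chain Z (U' \<union> Z x) xs"
    using Cons.IH[of "U \<union> Z x" "U' \<union> Z x"] Cons.prems by auto
  with Cons.prems show ?case by auto
qed simp

lemma fresh_chain_drop_middle:
  "fresh_chain Z U (xs @ y # ys) \<Longrightarrow> fresh_chain Z U (xs @ ys)"
  by (auto simp: fresh_chain_append intro: fresh_chain_mono)

text \<open>Servers \<open>I\<close>, datasets \<open>D\<close>, common load \<open>w\<close>,
  common replication \<open>r\<close>. For a secure scheme both regularity assumptions are forced by
  counting, see \<open>scheme.card_Z\<close> and \<open>scheme.card_holders\<close>.\<close>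

locale uniform_cover =
  fixes I :: "'i set" and D :: "'d set" and Z :: "'i \<Rightarrow> 'd set" and w r :: nat
  assumes finite_I: "finite I" and finite_D: "finite D"
    and Z_subset: "n \<in> I \<Longrightarrow> Z n \<subseteq> D"
    and card_Z: "n \<in> I \<Longrightarrow> card (Z n) = w"
    and w_pos: "0 < w"
    and card_holders: "k \<in> D \<Longrightarrow> card {n \<in> I. k \<in> Z n} = r"
begin

abbreviation cov :: "'i list \<Rightarrow> 'd set" where "cov xs \<equiv> \<Union>(Z ` set xs)"

lemma finite_Z: "n \<in> I \<Longrightarrow> finite (Z n)"
  using Z_subset finite_D finite_subset by blast

lemma double_count: "card D * r = card I * w"
proof -
  have "(\<Sum>k\<in>D. card {n \<in> I. k \<in> Z n}) = (\<Sum>n\<in>I. card {k \<in> D. k \<in> Z n})"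
    by (rule sum_multicount_gen) (use finite_I finite_D in auto)
  also have "\<dots> = (\<Sum>n\<in>I. card (Z n))"
    by (intro sum.cong refl arg_cong[of _ _ card]) (use Z_subset in auto)
  finally show ?thesis using card_holders card_Z by simp
qed

lemma card_cov_le: "set xs \<subseteq> I \<Longrightarrow> card (cov xs) \<le> length xs * w"
proof (induction xs)
  case (Cons x xs)
  have "card (cov (x # xs)) \<le> card (Z x) + card (cov xs)" by (simp add: card_Un_le)
  also have "\<dots> \<le> w + length xs * w" using Cons card_Z by (simp add: add_mono)
  finally show ?case by simp
qed simp

lemma cov_subset: "set xs \<subseteq> I \<Longrightarrow> cov xs \<subseteq> D"
  using Z_subset by blast

lemma finite_cov: "set xs \<subseteq> I \<Longrightarrow> finite (cov xs)"
  using finite_Z by blast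

text \<open>Greedy extension: any block of \<open>J\<close> that is not yet covered is appended, and
  the uncovered part of \<open>D\<close> shrinks. The set \<open>J\<close> allows a restriction to
  the blocks that avoid a given dataset.\<close>

lemma fresh_chain_complete_within:
  assumes "J \<subseteq> I"
  shows "\<exists>ys. set ys \<subseteq> J \<and> fresh_chain Z U ys \<and> \<Union>(Z ` J) \<subseteq> U \<union> cov ys"
proof (induction "card (D - U)" arbitrary: U rule: less_induct)
  case less
  show ?case
  proof (cases "\<Union>(Z ` J) \<subseteq> U")
    case True
    then show ?thesis by (intro exI[of _ "[]"]) auto
  next
    case False
    then obtain n where n: "n \<in> J" "\<not> Z n \<subseteq> U" by blast
    then have "D - (U \<union> Z n) \<subset> D - U" using Z_subset assms by blast
    then have "card (D - (U \<union> Z n)) < card (D - U)"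
      by (intro psubset_card_mono) (simp_all add: finite_D)
    from less[OF this] obtain ys where
      "set ys \<subseteq> J" "fresh_chain Z (U \<union> Z n) ys" "\<Union>(Z ` J) \<subseteq> U \<union> Z n \<union> cov ys" by blast
    with n show ?thesis by (intro exI[of _ "n # ys"]) auto
  qed
qed

lemma Union_Z: assumes "0 < r" shows "\<Union>(Z ` I) = D"
proof -
  have "\<exists>n\<in>I. k \<in> Z n" if "k \<in> D" for k
    using card_holders[OF that] assms by (metis (mono_tags, lifting) card.empty empty_Collect_eq less_irrefl)
  then show ?thesis using Z_subset by blast
qed

text \<open>A cover has |D| at most length times \<open>w\<close>, and \<open>double_count\<close>
  trades |D| for |I|.\<close>

lemma covering_length:
  assumes "set xs \<subseteq> I" "D \<subseteq> cov xs"
  shows "card I \<le> length xs * r"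
proof -
  have "card D \<le> card (cov xs)" by (rule card_mono[OF finite_cov[OF assms(1)] assms(2)])
  also have "\<dots> \<le> length xs * w" by (rule card_cov_le[OF assms(1)])
  finally have "card D * r \<le> length xs * w * r" by (rule mult_right_mono) simp
  then have "card I * w \<le> (length xs * r) * w" unfolding double_count by (simp only: mult_ac)
  then show ?thesis using w_pos by simp
qed

lemma exists_long_chain:
  assumes "0 < r"
  shows "\<exists>xs. set xs \<subseteq> I \<and> fresh_chain Z {} xs \<and> card I \<le> length xs * r"
proof -
  obtain xs where "set xs \<subseteq> I" "fresh_chain Z {} xs" "\<Union>(Z ` I) \<subseteq> {} \<union> cov xs"
    using fresh_chain_complete_within[of I "{}"] by blast
  with covering_length[of xs] Union_Z[OF assms] show ?thesis by auto
qed

text \<open>Here \<open>b\<close> is the first element of \<open>bs\<close> at which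
  \<open>A\<close> becomes covered.\<close>

lemma chain_prefix:
  assumes "\<not> A \<subseteq> B" "A \<subseteq> B \<union> cov bs"
  shows "\<exists>ps b qs. bs = ps @ b # qs \<and> \<not> A \<subseteq> B \<union> cov ps \<and> A \<subseteq> B \<union> cov ps \<union> Z b"
  using assms
proof (induction bs arbitrary: B)
  case (Cons x bs)
  show ?case
  proof (cases "A \<subseteq> B \<union> Z x")
    case True
    with Cons.prems show ?thesis by (intro exI[of _ "[]"]) auto
  next
    case False
    with Cons.IH[of "B \<union> Z x"] Cons.prems obtain ps b qs where
      "bs = ps @ b # qs" "\<not> A \<subseteq> B \<union> Z x \<union> cov ps" "A \<subseteq> B \<union> Z x \<union> cov ps \<union> Z b"
      by (auto simp: Un_assoc)
    then show ?thesis
      by (intro exI[of _ "x # ps"] exI[of _ b] exI[of _ qs]) (auto simp: Un_assoc)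
  qed
qed auto

text \<open>If all maximal chains have the same length, the unions of the blocks form a geometric
  lattice. Two blocks that meet without being equal then give three distinct blocks over a
  flat of corank two, any two of which cover the rest; this costs half a block.\<close>
lemma blocks_equal_or_disjoint:
  assumes r: "0 < r"
    and short: "\<And>xs. set xs \<subseteq> I \<Longrightarrow> fresh_chain Z {} xs \<Longrightarrow> length xs \<le> c"
    and gap: "(2 * c - 1) * r < 2 * card I"
    and i: "i \<in> I" and j: "j \<in> I" and k: "k \<in> Z i" "k \<in> Z j"
  shows "Z i = Z j"
proof (rule ccontr)
  assume neq: "Z i \<noteq> Z j"
  \<comment> \<open>Covers have at least c members by \<open>gap\<close>, chains at most c by
    \<open>short\<close>; hence every maximal chain has exactly c.\<close>
  have ge: "c \<le> length xs" if "set xs \<subseteq> I" "D \<subseteq> cov xs" for xs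
  proof (rule ccontr)
    assume "\<not> c \<le> length xs"
    then have "2 * length xs \<le> 2 * c - 1" by linarith
    then have "2 * length xs * r \<le> (2 * c - 1) * r" by (rule mult_right_mono) simp
    with covering_length[OF that] gap show False by linarith
  qed
  have full: "D \<subseteq> cov xs" if "set xs \<subseteq> I" "fresh_chain Z {} xs" "c \<le> length xs" for xs
  proof (rule ccontr)
    assume "\<not> D \<subseteq> cov xs"
    then obtain n where "n \<in> I" "\<not> Z n \<subseteq> cov xs" using Union_Z[OF r] by blast
    with that short[of "xs @ [n]"] show False by (auto simp: fresh_chain_append)
  qed
  have kD: "k \<in> D" using i k Z_subset by blast
  \<comment> \<open>The blocks avoiding k span a flat of corank one, with \<open>bs\<close> as a
    basis.\<close>
  let ?H = "{n \<in> I. k \<notin> Z n}"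
  obtain bs where bs: "set bs \<subseteq> ?H" "fresh_chain Z {} bs" "\<Union>(Z ` ?H) \<subseteq> cov bs"
    using fresh_chain_complete_within[of ?H "{}"] by auto
  have bsI: "set bs \<subseteq> I" using bs by blast
  have k_bs: "k \<notin> cov bs" using bs by auto
  \<comment> \<open>If no block avoiding k contains v, every holder of v holds k; both sets of
    holders have \<open>r\<close> elements, so they coincide.\<close>
  have rest: "D \<subseteq> Z x \<union> cov bs" if x: "x \<in> I" "k \<in> Z x" for x
  proof
    fix v assume v: "v \<in> D"
    show "v \<in> Z x \<union> cov bs"
    proof (cases "v \<in> cov bs")
      case False
      then have "{n \<in> I. v \<in> Z n} \<subseteq> {n \<in> I. k \<in> Z n}" using bs(3) by blast
      moreover have "card {n \<in> I. v \<in> Z n} = card {n \<in> I. k \<in> Z n}"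
        using card_holders v kD by simp
      ultimately have "{n \<in> I. v \<in> Z n} = {n \<in> I. k \<in> Z n}"
        using finite_I by (intro card_subset_eq) auto
      then show ?thesis using x by auto
    qed simp
  qed
  have len_bs: "length bs + 1 = c"
  proof (rule antisym)
    show "length bs + 1 \<le> c"
      using short[of "bs @ [i]"] bsI i k k_bs bs(2) by (auto simp: fresh_chain_append)
    show "c \<le> length bs + 1" using ge[of "bs @ [i]"] bsI i rest[OF i k(1)] by auto
  qed
  have "\<not> Z j \<subseteq> Z i"
    using card_subset_eq[OF finite_Z[OF i]] card_Z[OF i] card_Z[OF j] neq by auto
  \<comment> \<open>\<open>b\<close> is the member of \<open>bs\<close> whose addition first covers
    \<open>Z j\<close> over \<open>Z i\<close>; it is the block to be exchanged with j.\<close>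
  then have "\<exists>ps b qs. bs = ps @ b # qs \<and> \<not> Z j \<subseteq> Z i \<union> cov ps \<and> Z j \<subseteq> Z i \<union> cov ps \<union> Z b"
    by (rule chain_prefix) (use rest[OF i k(1)] Z_subset[OF j] in blast)
  then obtain ps b qs where split: "bs = ps @ b # qs"
    and np: "\<not> Z j \<subseteq> Z i \<union> cov ps" and p: "Z j \<subseteq> Z i \<union> cov ps \<union> Z b"
    by (elim exE conjE)
  have sI: "set ps \<subseteq> I" "b \<in> I" "set qs \<subseteq> I" using bsI split by auto
  have k_ps: "k \<notin> cov ps" "k \<notin> Z b" "k \<notin> cov qs" using k_bs split by auto
  have ps_chain: "fresh_chain Z {} (ps @ [i])"
    using bs(2) k k_ps unfolding split by (auto simp: fresh_chain_append)
  \<comment> \<open>Otherwise j could be inserted before b in a chain that starts with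
    \<open>ps @ [i, b]\<close> and covers \<open>D\<close>. That chain already has at least c
    members, so the result would be too long.\<close>
  have exch: "Z b \<subseteq> Z i \<union> cov ps \<union> Z j"
  proof (rule ccontr)
    assume nb: "\<not> Z b \<subseteq> Z i \<union> cov ps \<union> Z j"
    obtain ys where ys: "set ys \<subseteq> I" "fresh_chain Z (Z i \<union> cov ps \<union> Z b) ys"
      "\<Union>(Z ` I) \<subseteq> Z i \<union> cov ps \<union> Z b \<union> cov ys"
      using fresh_chain_complete_within[of I] by blast
    have "D \<subseteq> cov (ps @ [i, b] @ ys)" using ys(3) Union_Z[OF r] by auto
    then have "c \<le> length (ps @ [i, b] @ ys)" using sI i ys(1) by (intro ge) auto
    moreover
    have eq: "cov ps \<union> (Z i \<union> (Z j \<union> Z b)) = Z i \<union> cov ps \<union> Z b" using p by blast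
    have "fresh_chain Z {} ((ps @ [i]) @ [j, b] @ ys)"
      unfolding fresh_chain_append[of _ _ "ps @ [i]"]
      using ps_chain np nb ys(2) by (simp add: Un_ac eq[simplified Un_ac])
    then have "length ((ps @ [i]) @ [j, b] @ ys) \<le> c"
      by (rule short[rotated]) (use sI i j ys(1) in auto)
    ultimately show False by simp
  qed
  \<comment> \<open>Removing b from \<open>bs\<close> leaves c - 2 blocks; over them i, j and b are
    the three blocks any two of which cover \<open>D\<close>.\<close>
  let ?F = "ps @ qs"
  have F: "fresh_chain Z {} ?F" by (rule fresh_chain_drop_middle) (use bs(2) split in simp)
  have FI: "set ?F \<subseteq> I" using sI by simp
  have len_F: "length ?F + 2 = c" using len_bs split by simp
  have b_new: "\<not> Z b \<subseteq> Z i \<union> cov ?F"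
  proof
    assume "Z b \<subseteq> Z i \<union> cov ?F"
    then have "D \<subseteq> cov (?F @ [i])" using rest[OF i k(1)] split by auto
    moreover have "set (?F @ [i]) \<subseteq> I" using FI i by simp
    ultimately have "c \<le> length (?F @ [i])" by (intro ge)
    then show False using len_F by simp
  qed
  have j_new: "\<not> Z j \<subseteq> Z i \<union> cov ?F" using b_new exch by auto
  have kF: "k \<notin> cov ?F" using k_ps by auto
  have cover2: "D \<subseteq> cov (?F @ [x, y])"
    if "x \<in> I" "y \<in> I" "\<not> Z x \<subseteq> cov ?F" "\<not> Z y \<subseteq> cov ?F \<union> Z x" for x y
  proof (rule full)
    show "set (?F @ [x, y]) \<subseteq> I" using FI that by simp
    show "fresh_chain Z {} (?F @ [x, y])" unfolding fresh_chain_append[of _ _ ?F] using F that by simp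
    show "c \<le> length (?F @ [x, y])" using len_F by simp
  qed
  have ij: "D \<subseteq> cov (?F @ [i, j])" by (rule cover2[OF i j]) (use k kF j_new in auto)
  have bi: "D \<subseteq> cov (?F @ [b, i])" by (rule cover2[OF sI(2) i]) (use k k_ps kF b_new in auto)
  have bj: "D \<subseteq> cov (?F @ [b, j])" by (rule cover2[OF sI(2) j]) (use k k_ps kF b_new in auto)
  let ?V = "D - cov ?F"
  have fin: "finite ?V" "finite (Z i)" "finite (Z j)" "finite (Z b)"
    using finite_D finite_Z i j sI by auto
  \<comment> \<open>Since each pair of the three blocks covers \<open>?V\<close>, each point of
    \<open>?V\<close> lies in at least two of them.\<close>
  have "2 * card ?V \<le> card (Z i) + card (Z j) + card (Z b)"
  proof -
    have "card ?V + card ?V \<le> card (?V \<inter> Z i) + card (?V \<inter> Z j) + card (?V \<inter> Z b)"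
    proof -
      have "card ?V = card ((?V \<inter> Z i) \<union> (?V - Z i))" by (rule arg_cong[of _ _ card]) auto
      also have "\<dots> = card (?V \<inter> Z i) + card (?V - Z i)" by (rule card_Un_disjoint) (use fin in auto)
      also have "card (?V - Z i) \<le> card (?V \<inter> Z j \<inter> Z b)"
        by (rule card_mono) (use fin ij bi in auto)
      finally have 1: "card ?V \<le> card (?V \<inter> Z i) + card (?V \<inter> Z j \<inter> Z b)" by simp
      have "card ?V \<le> card ((?V \<inter> Z j) \<union> (?V \<inter> Z b))" by (rule card_mono) (use fin bj in auto)
      moreover have "card ((?V \<inter> Z j) \<union> (?V \<inter> Z b)) + card ((?V \<inter> Z j) \<inter> (?V \<inter> Z b))
          = card (?V \<inter> Z j) + card (?V \<inter> Z b)"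
        using card_Un_Int[of "?V \<inter> Z j" "?V \<inter> Z b"] fin by simp
      moreover have "(?V \<inter> Z j) \<inter> (?V \<inter> Z b) = ?V \<inter> Z j \<inter> Z b" by auto
      ultimately show ?thesis using 1 by simp
    qed
    moreover have "card (?V \<inter> Z x) \<le> card (Z x)" if "finite (Z x)" for x
      using that by (intro card_mono) auto
    note this[of i] this[of j] this[of b]
    ultimately show ?thesis using fin(2,3,4) by linarith
  qed
  then have V: "2 * card ?V \<le> 3 * w" using card_Z i j sI by simp
  have "card D \<le> card ?V + card (cov ?F)"
    using card_Un_le[of ?V "cov ?F"] cov_subset[OF FI] by (simp add: Un_absorb2)
  also have "\<dots> \<le> card ?V + length ?F * w" using card_cov_le[OF FI] by simp
  finally have "2 * card D \<le> 3 * w + 2 * (length ?F * w)" using V by linarith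
  also have "\<dots> = (2 * c - 1) * w" using len_F[symmetric] by (simp add: algebra_simps)
  finally have "2 * card D * r \<le> (2 * c - 1) * w * r" by (rule mult_right_mono) simp
  moreover have "2 * card D * r = 2 * card I * w" using double_count by simp
  ultimately have "(2 * card I) * w \<le> ((2 * c - 1) * r) * w" by (simp only: mult_ac)
  with gap w_pos show False by simp
qed

text \<open>Blocks are equal or disjoint, so the indices of one block are exactly the holders of any
  of its points. Thus \<open>I\<close> splits into classes of size \<open>r\<close>.\<close>

lemma dvd_of_short_chains:
  assumes r: "0 < r"
    and short: "\<And>xs. set xs \<subseteq> I \<Longrightarrow> fresh_chain Z {} xs \<Longrightarrow> length xs \<le> c"
    and gap: "(2 * c - 1) * r < 2 * card I"
  shows "r dvd card I"
proof -
  have "card {n \<in> I. Z n = B} = r" if B: "B \<in> Z ` I" for B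
  proof -
    obtain n where n: "n \<in> I" "B = Z n" using B by blast
    have "Z n \<noteq> {}" using card_Z[OF n(1)] w_pos by auto
    then obtain k where k: "k \<in> Z n" by blast
    have "Z n' = Z n" if "n' \<in> I" "k \<in> Z n'" for n'
      by (rule blocks_equal_or_disjoint[OF r _ gap that(1) n(1) that(2) k]) (rule short)
    then have "{n' \<in> I. Z n' = B} = {n' \<in> I. k \<in> Z n'}"
      unfolding n(2) using k by (intro Collect_cong) metis
    moreover have "k \<in> D" using Z_subset[OF n(1)] k by blast
    ultimately show ?thesis using card_holders by simp
  qed
  moreover have "card I = (\<Sum>B\<in>Z ` I. card {n \<in> I. Z n = B})"
    unfolding card_eq_sum by (rule sum.image_gen[OF finite_I])
  ultimately show ?thesis by simp
qed

end

section \<open>Entropy\<close>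

lemma sum_map_pmf:
  fixes g :: "'y \<Rightarrow> real"
  assumes "finite (set_pmf P)"
  shows "(\<Sum>y\<in>set_pmf (map_pmf f P). pmf (map_pmf f P) y * g y) = (\<Sum>x\<in>set_pmf P. pmf P x * g (f x))"
proof -
  have "(\<Sum>y\<in>set_pmf (map_pmf f P). pmf (map_pmf f P) y * g y) = measure_pmf.expectation (map_pmf f P) g"
    using assms by (subst integral_measure_pmf_real[where A = "set_pmf (map_pmf f P)"]) (auto simp: mult.commute)
  also have "\<dots> = measure_pmf.expectation P (\<lambda>x. g (f x))" by simp
  also have "\<dots> = (\<Sum>x\<in>set_pmf P. pmf P x * g (f x))"
    using assms by (subst integral_measure_pmf_real[where A = "set_pmf P"]) (auto simp: mult.commute)
  finally show ?thesis .
qed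

lemma ent_map_pmf:
  assumes "finite (set_pmf P)"
  shows "ent b (map_pmf f P) = - (\<Sum>x\<in>set_pmf P. pmf P x * log b (pmf (map_pmf f P) (f x)))"
  unfolding ent_def using sum_map_pmf[OF assms, of f "\<lambda>y. log b (pmf (map_pmf f P) y)"] by simp

lemma ent_map_pmf_inj:
  assumes "finite (set_pmf P)" "inj_on f (set_pmf P)"
  shows "ent b (map_pmf f P) = ent b P"
  unfolding ent_map_pmf[OF assms(1)] using assms by (simp add: pmf_map_inj ent_def)

lemma ent_map_pmf_le:
  assumes "finite (set_pmf P)" "1 < b"
  shows "ent b (map_pmf f P) \<le> ent b P"
proof -
  have "pmf P x * log b (pmf P x) \<le> pmf P x * log b (pmf (map_pmf f P) (f x))"
    if "x \<in> set_pmf P" for x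
  proof -
    have "pmf P x \<le> pmf (map_pmf f P) (f x)"
      unfolding pmf_map unfolding pmf.rep_eq by (rule measure_pmf.finite_measure_mono) auto
    moreover have "0 < pmf P x" using that by (simp add: pmf_positive)
    ultimately show ?thesis using assms by (intro mult_left_mono log_mono) auto
  qed
  then show ?thesis unfolding ent_map_pmf[OF assms(1)] unfolding ent_def by (auto intro: sum_mono)
qed

text \<open>Entropy is at least min-entropy: the average of -log p is at least its minimum.\<close>

lemma ent_ge_of_pmf_le:
  assumes "finite (set_pmf P)" "1 < b" "\<And>x. x \<in> set_pmf P \<Longrightarrow> pmf P x \<le> 1 / b ^ c"
  shows "real c \<le> ent b P"
proof -
  have "pmf P x * real c \<le> pmf P x * (- log b (pmf P x))" if "x \<in> set_pmf P" for x
  proof -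
    have "log b (pmf P x) \<le> log b (1 / b ^ c)"
      using assms that by (intro log_mono) (auto simp: pmf_positive)
    also have "\<dots> = - real c" using assms(2) by (simp add: log_divide log_nat_power)
    finally show ?thesis by (intro mult_left_mono) auto
  qed
  then have "(\<Sum>x\<in>set_pmf P. pmf P x * real c) \<le> (\<Sum>x\<in>set_pmf P. pmf P x * (- log b (pmf P x)))"
    by (rule sum_mono)
  moreover have "(\<Sum>x\<in>set_pmf P. pmf P x * real c) = real c"
    using sum_pmf_eq_1[OF assms(1) order_refl] by (simp flip: sum_distrib_right)
  ultimately show ?thesis by (simp add: ent_def sum_negf)
qed

text \<open>Gibbs' inequality against the uniform law on \<open>A\<close>, from ln x <= x -
  1.\<close>

lemma ent_le_log_card:
  assumes "finite A" "set_pmf P \<subseteq> A" "1 < b"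
  shows "ent b P \<le> log b (card A)"
proof -
  let ?S = "set_pmf P" and ?n = "real (card A)"
  have fin: "finite ?S" using assms finite_subset by blast
  have n: "?n > 0" using assms set_pmf_not_empty[of P] by (metis card_gt_0_iff of_nat_0_less_iff subset_empty)
  have "pmf P x * (- log b (pmf P x) - log b ?n) \<le> (1 / ?n - pmf P x) / ln b" if "x \<in> ?S" for x
  proof -
    let ?p = "pmf P x"
    have p: "?p > 0" using that by (simp add: pmf_positive)
    have "- log b ?p - log b ?n = ln (1 / (?n * ?p)) / ln b"
      using p n by (simp add: log_def ln_div ln_mult diff_divide_distrib)
    also have "\<dots> \<le> (1 / (?n * ?p) - 1) / ln b"
      using p n assms(3) by (intro divide_right_mono ln_le_minus_one) auto
    finally have "?p * (- log b ?p - log b ?n) \<le> ?p * ((1 / (?n * ?p) - 1) / ln b)"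
      using p by (intro mult_left_mono) auto
    also have "?p * ((1 / (?n * ?p) - 1) / ln b) = (?p * (1 / (?n * ?p) - 1)) / ln b" by simp
    also have "?p * (1 / (?n * ?p) - 1) = 1 / ?n - ?p" using p n by (simp add: field_simps)
    finally show ?thesis .
  qed
  then have "(\<Sum>x\<in>?S. pmf P x * (- log b (pmf P x) - log b ?n)) \<le> (\<Sum>x\<in>?S. (1 / ?n - pmf P x) / ln b)"
    by (rule sum_mono)
  also have "\<dots> = (card ?S / ?n - 1) / ln b"
    using sum_pmf_eq_1[OF fin order_refl] by (simp add: sum_subtractf flip: sum_divide_distrib)
  also have "\<dots> \<le> 0"
  proof -
    have "card ?S \<le> card A" using assms by (intro card_mono)
    then show ?thesis using n assms(3) by (intro divide_nonpos_pos) (auto simp: field_simps)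
  qed
  also have "(\<Sum>x\<in>?S. pmf P x * (- log b (pmf P x) - log b ?n)) = ent b P - log b ?n"
    using sum_pmf_eq_1[OF fin order_refl]
    by (simp add: ent_def right_diff_distrib sum_subtractf sum_negf flip: sum_distrib_right)
  finally show ?thesis by simp
qed

lemma ent_pmf_of_set:
  assumes "finite A" "A \<noteq> {}"
  shows "ent b (pmf_of_set A) = log b (card A)"
  using assms by (simp add: ent_def log_divide log_recip flip: sum_distrib_left)

section \<open>Chain rule and conditional mutual information\<close>

lemma pmf_bind_map_Pair:
  "pmf (bind_pmf A (\<lambda>w. map_pmf (Pair w) (\<kappa> w))) (w, x) = pmf A w * pmf (\<kappa> w) x"
proof -
  have "pmf (map_pmf (Pair v) (\<kappa> v)) (w, x) = indicator {w} v * pmf (\<kappa> w) x" for v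
    by (cases "v = w") (auto simp: pmf_map_inj' inj_def intro: pmf_map_outside)
  moreover have "measure_pmf.expectation A (\<lambda>v. indicator {w} v * pmf (\<kappa> w) x) = pmf A w * pmf (\<kappa> w) x"
    by (simp add: pmf.rep_eq)
  ultimately show ?thesis by (simp add: pmf_bind)
qed

text \<open>Chain rule, with \<kappa> w as the conditional law of the second component given
  w.\<close>

lemma ent_bind_map_Pair:
  assumes "finite (set_pmf A)" "\<And>w. w \<in> set_pmf A \<Longrightarrow> finite (set_pmf (\<kappa> w))" "1 < b"
  shows "ent b (bind_pmf A (\<lambda>w. map_pmf (Pair w) (\<kappa> w)))
    = ent b A + (\<Sum>w\<in>set_pmf A. pmf A w * ent b (\<kappa> w))"
proof -
  let ?J = "bind_pmf A (\<lambda>w. map_pmf (Pair w) (\<kappa> w))"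
  have set: "set_pmf ?J = Sigma (set_pmf A) (\<lambda>w. set_pmf (\<kappa> w))" by auto
  have "ent b ?J = - (\<Sum>(w, x)\<in>Sigma (set_pmf A) (\<lambda>w. set_pmf (\<kappa> w)). pmf ?J (w, x) * log b (pmf ?J (w, x)))"
    unfolding ent_def set by (simp add: case_prod_unfold)
  also have "\<dots> = - (\<Sum>w\<in>set_pmf A. \<Sum>x\<in>set_pmf (\<kappa> w). pmf ?J (w, x) * log b (pmf ?J (w, x)))"
    using assms by (subst sum.Sigma) auto
  also have "(\<Sum>w\<in>set_pmf A. \<Sum>x\<in>set_pmf (\<kappa> w). pmf ?J (w, x) * log b (pmf ?J (w, x)))
    = (\<Sum>w\<in>set_pmf A. pmf A w * log b (pmf A w) - pmf A w * ent b (\<kappa> w))"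
  proof (rule sum.cong[OF refl])
    fix w assume w: "w \<in> set_pmf A"
    have "(\<Sum>x\<in>set_pmf (\<kappa> w). pmf ?J (w, x) * log b (pmf ?J (w, x)))
      = (\<Sum>x\<in>set_pmf (\<kappa> w). pmf A w * log b (pmf A w) * pmf (\<kappa> w) x
          + pmf A w * (pmf (\<kappa> w) x * log b (pmf (\<kappa> w) x)))"
      using w by (intro sum.cong refl)
        (simp add: pmf_bind_map_Pair log_mult pmf_positive less_imp_neq[symmetric] algebra_simps)
    also have "\<dots> = pmf A w * log b (pmf A w) - pmf A w * ent b (\<kappa> w)"
      using sum_pmf_eq_1[OF assms(2)[OF w] order_refl]
      by (simp add: sum.distrib ent_def flip: sum_distrib_left)
    finally show "(\<Sum>x\<in>set_pmf (\<kappa> w). pmf ?J (w, x) * log b (pmf ?J (w, x)))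
      = pmf A w * log b (pmf A w) - pmf A w * ent b (\<kappa> w)" .
  qed
  also have "- (\<Sum>w\<in>set_pmf A. pmf A w * log b (pmf A w) - pmf A w * ent b (\<kappa> w))
    = ent b A + (\<Sum>w\<in>set_pmf A. pmf A w * ent b (\<kappa> w))"
    by (simp add: sum_subtractf ent_def[of b A])
  finally show ?thesis .
qed

lemma pair_pmf_conv_bind_map: "pair_pmf A P = bind_pmf A (\<lambda>w. map_pmf (Pair w) P)"
  by (simp add: pair_pmf_def map_pmf_def)

lemma ent_pair_pmf:
  assumes "finite (set_pmf A)" "finite (set_pmf P)" "1 < b"
  shows "ent b (pair_pmf A P) = ent b A + ent b P"
  using sum_pmf_eq_1[OF assms(1) order_refl] assms
  by (simp add: pair_pmf_conv_bind_map ent_bind_map_Pair flip: sum_distrib_right)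

text \<open>W, \<sigma>(W), X form a Markov chain. By the chain rule, conditioning X on W or only on
  \<sigma>(W) gives the same entropy, namely the mean entropy of \<kappa>(\<sigma> w), so the terms
  of \<open>cmi\<close> cancel.\<close>

lemma cmi_eq_0_if_law_factors:
  assumes finA: "finite (set_pmf A)" and finP: "finite (set_pmf P)" and b: "1 < b"
    and law: "\<And>w. w \<in> set_pmf A \<Longrightarrow> map_pmf (\<lambda>q. X (w, q)) P = \<kappa> (\<sigma> w)"
  shows "cmi b (pair_pmf A P) fst X (\<lambda>z. \<sigma> (fst z)) = 0"
proof -
  let ?J = "pair_pmf A P"
  have fin\<kappa>: "finite (set_pmf (\<kappa> (\<sigma> w)))" if "w \<in> set_pmf A" for w
    using finP law[OF that, symmetric] by simp
  have "ent b (map_pmf (\<lambda>z. (fst z, \<sigma> (fst z))) ?J) = ent b (map_pmf (\<lambda>w. (w, \<sigma> w)) (map_pmf fst ?J))"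
    by (simp add: map_pmf_comp del: map_fst_pair_pmf)
  then have 1: "ent b (map_pmf (\<lambda>z. (fst z, \<sigma> (fst z))) ?J) = ent b A"
    using finA by (simp add: map_fst_pair_pmf ent_map_pmf_inj inj_on_def)
  have XW: "bind_pmf A (\<lambda>w. map_pmf (\<lambda>q. (w, X (w, q))) P) = bind_pmf A (\<lambda>w. map_pmf (Pair w) (\<kappa> (\<sigma> w)))"
    by (intro bind_pmf_cong refl) (simp add: law[symmetric] map_pmf_comp)
  have "map_pmf (\<lambda>z. (fst z, X z, \<sigma> (fst z))) ?J
    = map_pmf (\<lambda>(w, x). (w, x, \<sigma> w)) (bind_pmf A (\<lambda>w. map_pmf (\<lambda>q. (w, X (w, q))) P))"
    by (simp add: pair_pmf_conv_bind_map map_bind_pmf map_pmf_comp)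
  then have 2: "ent b (map_pmf (\<lambda>z. (fst z, X z, \<sigma> (fst z))) ?J)
      = ent b A + (\<Sum>w\<in>set_pmf A. pmf A w * ent b (\<kappa> (\<sigma> w)))"
    unfolding XW using fin\<kappa> finA b
    by (subst ent_bind_map_Pair[symmetric]) (auto intro!: ent_map_pmf_inj simp: inj_on_def)
  have "map_pmf (\<lambda>z. (X z, \<sigma> (fst z))) ?J
    = map_pmf (\<lambda>(w, x). (x, \<sigma> w)) (bind_pmf A (\<lambda>w. map_pmf (\<lambda>q. (w, X (w, q))) P))"
    by (simp add: pair_pmf_conv_bind_map map_bind_pmf map_pmf_comp)
  also have "\<dots> = map_pmf (\<lambda>(s, x). (x, s)) (bind_pmf (map_pmf \<sigma> A) (\<lambda>s. map_pmf (Pair s) (\<kappa> s)))"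
    unfolding XW by (simp add: map_bind_pmf bind_map_pmf map_pmf_comp)
  finally have "ent b (map_pmf (\<lambda>z. (X z, \<sigma> (fst z))) ?J)
    = ent b (bind_pmf (map_pmf \<sigma> A) (\<lambda>s. map_pmf (Pair s) (\<kappa> s)))"
    using fin\<kappa> finA by (auto intro!: ent_map_pmf_inj simp: inj_on_def)
  also have "\<dots> = ent b (map_pmf \<sigma> A) + (\<Sum>w\<in>set_pmf A. pmf A w * ent b (\<kappa> (\<sigma> w)))"
    using fin\<kappa> finA b sum_map_pmf[OF finA, of \<sigma> "\<lambda>s. ent b (\<kappa> s)"]
    by (subst ent_bind_map_Pair) auto
  finally have 3: "ent b (map_pmf (\<lambda>z. (X z, \<sigma> (fst z))) ?J)
    = ent b (map_pmf \<sigma> A) + (\<Sum>w\<in>set_pmf A. pmf A w * ent b (\<kappa> (\<sigma> w)))" .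
  have 4: "map_pmf (\<lambda>z. \<sigma> (fst z)) ?J = map_pmf \<sigma> A"
    using map_pmf_comp[of \<sigma> fst ?J] by (simp add: map_fst_pair_pmf)
  show ?thesis unfolding cmi_def 1 2 3 4 by simp
qed

text \<open>Zero information gives H(X | \<sigma>) = H(X | W), which is at most the entropy of
  \<open>P\<close> because X is a function of W and the randomness. On the other side H(X |
  \<sigma>) >= H(X) - H(\<sigma>).\<close>

lemma cmi_zero_imp_ent_ge:
  assumes finA: "finite (set_pmf A)" and finP: "finite (set_pmf P)" and b: "1 < b"
    and cmi: "cmi b (pair_pmf A P) fst X (\<lambda>z. \<sigma> (fst z)) = 0"
    and X: "real c \<le> ent b (map_pmf X (pair_pmf A P))"
    and \<sigma>: "ent b (map_pmf \<sigma> A) \<le> l"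
  shows "real c - l \<le> ent b P"
proof -
  let ?J = "pair_pmf A P"
  have finJ: "finite (set_pmf ?J)" using finA finP by simp
  have "ent b (map_pmf (\<lambda>z. (fst z, \<sigma> (fst z))) ?J) = ent b (map_pmf (\<lambda>w. (w, \<sigma> w)) (map_pmf fst ?J))"
    by (simp add: map_pmf_comp del: map_fst_pair_pmf)
  then have 1: "ent b (map_pmf (\<lambda>z. (fst z, \<sigma> (fst z))) ?J) = ent b A"
    using finA by (simp add: map_fst_pair_pmf ent_map_pmf_inj inj_on_def)
  have 2: "ent b (map_pmf (\<lambda>z. (fst z, X z, \<sigma> (fst z))) ?J) \<le> ent b A + ent b P"
    using ent_map_pmf_le[OF finJ b] ent_pair_pmf[OF finA finP b] by metis
  have "ent b (map_pmf fst (map_pmf (\<lambda>z. (X z, \<sigma> (fst z))) ?J)) \<le> ent b (map_pmf (\<lambda>z. (X z, \<sigma> (fst z))) ?J)"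
    using finJ b by (intro ent_map_pmf_le) auto
  then have 3: "real c \<le> ent b (map_pmf (\<lambda>z. (X z, \<sigma> (fst z))) ?J)"
    using X by (simp add: map_pmf_comp)
  have 4: "map_pmf (\<lambda>z. \<sigma> (fst z)) ?J = map_pmf \<sigma> A"
    using map_pmf_comp[of \<sigma> fst ?J] by (simp add: map_fst_pair_pmf)
  show ?thesis using cmi 2 3 \<sigma> unfolding cmi_def 1 4 by linarith
qed

section \<open>The function h\<close>

declare h.simps [simp del]

lemma h_div_gcd:
  assumes "0 < m" "m \<le> n"
  shows "h n m = h (n div gcd n m) (m div gcd n m)"
  using assms by (cases "gcd n m > 1") (auto simp: h.simps[of n m] not_less le_Suc_eq)

text \<open>Rule (3) strips all j blocks at once, since n div m = 1. This is the counterpart of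
  \<open>design_add_blocks\<close>.\<close>

lemma h_add_mult:
  assumes "2 \<le> m" "m < n" "n < 2 * m" "coprime n m"
  shows "h (n + j * m) m = h n m + j"
proof (cases "j = 0")
  case False
  have "gcd (n + j * m) m = 1" using assms
    by (metis add.commute coprime_iff_gcd_eq_1 gcd.commute gcd_add_mult)
  moreover have "n div m = 1" using assms by (auto simp: div_nat_eqI)
  then have "(n + j * m) div m - 1 = j" using assms by simp
  moreover have "n + j * m > 2 * m" using assms False by (cases j) auto
  ultimately show ?thesis using assms by (subst h.simps) simp
qed simp

lemma h_1_right: "0 < n \<Longrightarrow> h n 1 = n"
  by (subst h.simps) simp

text \<open>The pairs with m < n < 2 m, n coprime to m and 2 <= m <= 4, one for each residue
  class.\<close>

lemma h_base_values: "h 3 2 = 2" "h 4 3 = 2" "h 5 3 = 3" "h 5 4 = 2" "h 7 4 = 3"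
proof -
  have g: "gcd 3 2 = (1::nat)" "gcd 4 3 = (1::nat)" "gcd 5 3 = (1::nat)" "gcd 5 4 = (1::nat)" "gcd 7 4 = (1::nat)"
    by (simp_all add: gcd_non_0_nat)
  show *: "h 3 2 = 2" by (simp add: h.simps[of 3 2] h_1_right g del: One_nat_def)
  show **: "h 4 3 = 2" by (simp add: h.simps[of 4 3] * g)
  show "h 5 3 = 3" by (simp add: h.simps[of 5 3] g)
  show "h 5 4 = 2" by (simp add: h.simps[of 5 4] ** g)
  show "h 7 4 = 3" by (simp add: h.simps[of 7 4] * g)
qed

text \<open>The place where m <= 4 enters: a residue coprime to such an m >= 2 is 1 or m - 1. The
  multiple of m is split off so that the representative lies between m and 2 m.\<close>

lemma coprime_small_cases:
  fixes n m :: nat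
  assumes "coprime n m" "0 < m" "m \<le> n" "m \<le> 4"
  obtains (one) "m = 1"
    | (succ) j where "2 \<le> m" "n = (m + 1) + j * m"
    | (five) j where "m = 3" "n = 5 + j * 3"
    | (seven) j where "m = 4" "n = 7 + j * 4"
proof -
  define q r where "q = n div m" and "r = n mod m"
  have n: "n = q * m + r" and r: "r < m" using assms by (simp_all add: q_def r_def)
  have "1 \<le> q" using assms by (simp add: q_def div_greater_zero_iff Suc_le_eq)
  then obtain j where "q = j + 1" by (metis add.commute le_Suc_ex)
  with n have n: "n = (m + r) + j * m" by simp
  have cop: "coprime r m" using assms(1,2) by (simp add: r_def coprime_mod_left_iff)
  consider "m = 1" | "m = 2" | "m = 3" | "m = 4" using assms by linarith
  then show ?thesis
  proof cases
    case 2
    with r cop have "r = 1" by (cases "r = 0") auto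
    then show ?thesis using 2 n succ by simp
  next
    case 3
    with r cop have "r = 1 \<or> r = 2" by (cases "r = 0") auto
    then show ?thesis using 3 n succ five by fastforce
  next
    case 4
    have "r \<noteq> 0" using cop 4 by (cases "r = 0") auto
    moreover have "r \<noteq> 2" using cop 4 coprime_common_divisor[of "2::nat" 4 2] by auto
    ultimately have "r = 1 \<or> r = 3" using r 4 by linarith
    then show ?thesis using 4 n succ seven by fastforce
  qed (use one in simp)
qed

lemma h_succ: "2 \<le> m \<Longrightarrow> m \<le> 4 \<Longrightarrow> h (m + 1) m = 2"
  using h_base_values by (auto simp: le_Suc_eq numeral_eq_Suc)

lemma h_succ_add:
  assumes "2 \<le> m" "m \<le> 4"
  shows "h ((m + 1) + j * m) m = 2 + j"
  using h_add_mult[of m "m + 1" j] h_succ[OF assms] assms by simp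

lemma h_five_add: "h (5 + j * 3) 3 = 3 + j"
  using h_add_mult[of 3 5 j] h_base_values by (simp add: coprime_iff_gcd_eq_1 gcd_non_0_nat)

lemma h_seven_add: "h (7 + j * 4) 4 = 3 + j"
  using h_add_mult[of 4 7 j] h_base_values by (simp add: coprime_iff_gcd_eq_1 gcd_non_0_nat)

section \<open>Linear designs\<close>

context field
begin

lemma finsum_lessThan_Suc:
  "f \<in> {..<Suc n} \<rightarrow> carrier R \<Longrightarrow> finsum R f {..<Suc n} = f n \<oplus> finsum R f {..<n}"
  by (simp add: lessThan_Suc finsum_insert Pi_iff)

text \<open>Pairing of the form (u; v) with the vector (t; y). The coordinate t is kept apart
  because it alone has to be recovered.\<close>

definition lin :: "nat \<Rightarrow> 'a \<Rightarrow> (nat \<Rightarrow> 'a) \<Rightarrow> 'a \<Rightarrow> (nat \<Rightarrow> 'a) \<Rightarrow> 'a" where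
  "lin d u v t y = u \<otimes> t \<oplus> (\<Oplus>j\<in>{..<d}. v j \<otimes> y j)"

lemma lin_closed [simp]:
  "\<lbrakk>u \<in> carrier R; t \<in> carrier R; v \<in> {..<d} \<rightarrow> carrier R; y \<in> {..<d} \<rightarrow> carrier R\<rbrakk>
    \<Longrightarrow> lin d u v t y \<in> carrier R"
  unfolding lin_def by (intro a_closed m_closed finsum_closed) (auto simp: Pi_iff)

lemma lin_0: "\<lbrakk>u \<in> carrier R; t \<in> carrier R\<rbrakk> \<Longrightarrow> lin 0 u v t y = u \<otimes> t"
  by (simp add: lin_def)

lemma lin_Suc:
  "\<lbrakk>u \<in> carrier R; t \<in> carrier R; v \<in> {..<Suc d} \<rightarrow> carrier R; y \<in> {..<Suc d} \<rightarrow> carrier R\<rbrakk>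
    \<Longrightarrow> lin (Suc d) u v t y = lin d u v t y \<oplus> v d \<otimes> y d"
  unfolding lin_def
  by (subst finsum_lessThan_Suc) (auto simp: Pi_iff a_ac intro!: finsum_closed)

lemma lin_cong:
  assumes "\<And>j. j < d \<Longrightarrow> v j = v' j" "\<And>j. j < d \<Longrightarrow> y j = y' j"
    "v' \<in> {..<d} \<rightarrow> carrier R" "y' \<in> {..<d} \<rightarrow> carrier R"
  shows "lin d u v t y = lin d u v' t y'"
  unfolding lin_def using assms by (intro arg_cong[of _ _ "\<lambda>s. u \<otimes> t \<oplus> s"] finsum_cong') (auto simp: Pi_iff)

text \<open>There are n server types and n dataset types. A server of type i sends
  the linear form lin (u i) (v i), evaluated at the sum t of the messages and at d masked
  combinations y of the messages in which datasets of type k have the coefficients b k. The first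
  bound gives decodability, since n - m + 1 vanishing forms force t = 0; the second one bounds
  the number of dataset types that a server needs.\<close>
definition design ::
  "nat \<Rightarrow> nat \<Rightarrow> nat \<Rightarrow> (nat \<Rightarrow> 'a) \<Rightarrow> (nat \<Rightarrow> nat \<Rightarrow> 'a) \<Rightarrow> (nat \<Rightarrow> nat \<Rightarrow> 'a) \<Rightarrow> bool" where
  "design n m d u v b \<longleftrightarrow>
     (\<forall>i<n. u i \<in> carrier R \<and> v i \<in> {..<d} \<rightarrow> carrier R) \<and>
     (\<forall>k<n. b k \<in> {..<d} \<rightarrow> carrier R) \<and>
     (\<forall>t\<in>carrier R - {\<zero>}. \<forall>y\<in>{..<d} \<rightarrow> carrier R.
        card {i \<in> {..<n}. lin d (u i) (v i) t y = \<zero>} \<le> n - m) \<and>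
     (\<forall>i<n. card {k \<in> {..<n}. lin d (u i) (v i) \<one> (b k) \<noteq> \<zero>} \<le> m)"

lemma design_1_1: "design 1 1 0 (\<lambda>_. \<one>) v b"
  unfolding design_def by (auto simp: lin_0 intro: card_mono[of "{..<1}", simplified])

lemma affine_root_unique:
  assumes "a \<otimes> s \<oplus> c = \<zero>" "a' \<otimes> s \<oplus> c = \<zero>" "s \<noteq> \<zero>"
    and [simp]: "a \<in> carrier R" "a' \<in> carrier R" "s \<in> carrier R" "c \<in> carrier R"
  shows "a = a'"
proof -
  have "a \<otimes> s = a' \<otimes> s" using assms(1,2) by (metis add.inv_unique' assms(4-7) m_closed minus_equality)
  then show ?thesis using assms(3) m_rcancel by simp
qed

lemma card_le_1I:
  assumes "\<And>i j. i \<in> A \<Longrightarrow> j \<in> A \<Longrightarrow> i = j"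
  shows "card A \<le> 1"
  using assms by (metis card.infinite card_le_Suc0_iff_eq One_nat_def le0)

text \<open>Server i evaluates the affine polynomial z t + y 0 at z = x i, which has at most one
  root when t is nonzero. Dataset type k is the polynomial z - x k; server k annihilates it, so m
  types remain.\<close>

lemma design_succ:
  assumes x: "\<And>i. i < m + 1 \<Longrightarrow> x i \<in> carrier R" "inj_on x {..<m + 1}"
  shows "design (m + 1) m 1 x (\<lambda>_ _. \<one>) (\<lambda>k _. \<ominus> x k)"
proof -
  have lin1: "lin 1 (x i) (\<lambda>_. \<one>) t y = x i \<otimes> t \<oplus> y 0"
    if "i < m + 1" "t \<in> carrier R" "y \<in> {..<1} \<rightarrow> carrier R" for i t y
    using that x by (simp add: lin_Suc lin_0 Pi_iff)
  show ?thesis unfolding design_def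
  proof (intro conjI allI impI ballI)
    fix t y assume t: "t \<in> carrier R - {\<zero>}" and y: "y \<in> {..<1::nat} \<rightarrow> carrier R"
    have "card {i \<in> {..<m + 1}. lin 1 (x i) (\<lambda>_. \<one>) t y = \<zero>} \<le> 1"
    proof (rule card_le_1I)
      fix i j assume "i \<in> {i \<in> {..<m + 1}. lin 1 (x i) (\<lambda>_. \<one>) t y = \<zero>}"
        "j \<in> {i \<in> {..<m + 1}. lin 1 (x i) (\<lambda>_. \<one>) t y = \<zero>}"
      then have ij: "i < m + 1" "j < m + 1" "x i \<otimes> t \<oplus> y 0 = \<zero>" "x j \<otimes> t \<oplus> y 0 = \<zero>"
        using lin1 t y by auto
      then have "x i = x j" using t y x(1) by (intro affine_root_unique[of "x i" t "y 0" "x j"]) auto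
      then show "i = j" using x(2) ij by (auto dest: inj_onD)
    qed
    then show "card {i \<in> {..<m + 1}. lin 1 (x i) (\<lambda>_. \<one>) t y = \<zero>} \<le> m + 1 - m" by simp
  next
    fix i assume i: "i < m + 1"
    have "card {k \<in> {..<m + 1}. lin 1 (x i) (\<lambda>_. \<one>) \<one> (\<lambda>_. \<ominus> x k) \<noteq> \<zero>} \<le> card ({..<m + 1} - {i})"
      using i x(1) lin1[OF i] by (intro card_mono) (auto simp: r_neg)
    then show "card {k \<in> {..<m + 1}. lin 1 (x i) (\<lambda>_. \<one>) \<one> (\<lambda>_. \<ominus> x k) \<noteq> \<zero>} \<le> m" using i by simp
  qed (use x(1) in auto)
qed

text \<open>Direct sum with a block of m servers that all send the new combination y d. The old servers
  see t - y d as their sum, so that t remains the total.\<close>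
lemma design_add_block:
  assumes D: "design n m d u v b" and mn: "m \<le> n"
  shows "\<exists>u v b. design (n + m) m (Suc d) u v b"
proof -
  define u' where "u' i = (if i < n then u i else \<zero>)" for i
  \<comment> \<open>The coefficient of y d is minus \<open>u i\<close> because old forms are
    evaluated at t - y d instead of t.\<close>
  define v' where "v' i j = (if i < n then if j < d then v i j else \<ominus> u i
    else if j < d then \<zero> else \<one>)" for i j
  \<comment> \<open>The new combination collects the new datasets with coefficient one and no old
    dataset.\<close>
  define b' where "b' k j = (if k < n then if j < d then b k j else \<zero>
    else if j < d then \<zero> else \<one>)" for k j
  have u: "u i \<in> carrier R" and v: "v i \<in> {..<d} \<rightarrow> carrier R" and b: "b i \<in> {..<d} \<rightarrow> carrier R" if "i < n" for i
    using D that by (auto simp: design_def)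
  have kill: "card {i \<in> {..<n}. lin d (u i) (v i) t y = \<zero>} \<le> n - m"
    if "t \<in> carrier R" "t \<noteq> \<zero>" "y \<in> {..<d} \<rightarrow> carrier R" for t y
    using D that by (auto simp: design_def)
  have load: "card {k \<in> {..<n}. lin d (u i) (v i) \<one> (b k) \<noteq> \<zero>} \<le> m" if "i < n" for i
    using D that by (auto simp: design_def)
  have u'c: "u' i \<in> carrier R" and v'c: "v' i \<in> {..<Suc d} \<rightarrow> carrier R" and b'c: "b' i \<in> {..<Suc d} \<rightarrow> carrier R" for i
    using u[of i] v[of i] b[of i] by (auto simp: u'_def v'_def b'_def Pi_iff)
  have old: "lin (Suc d) (u' i) (v' i) t y = lin d (u i) (v i) (t \<ominus> y d) y"
    if i: "i < n" and t: "t \<in> carrier R" and y: "y \<in> {..<Suc d} \<rightarrow> carrier R" for i t y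
  proof -
    have yd: "y d \<in> carrier R" "y \<in> {..<d} \<rightarrow> carrier R" using y by auto
    have "lin (Suc d) (u' i) (v' i) t y = lin d (u' i) (v' i) t y \<oplus> v' i d \<otimes> y d"
      by (rule lin_Suc[OF u'c t v'c y])
    also have "lin d (u' i) (v' i) t y = lin d (u i) (v i) t y"
      using i v[OF i] yd unfolding u'_def by (simp, intro lin_cong) (auto simp: v'_def)
    also have "v' i d = \<ominus> u i" using i by (simp add: v'_def)
    also have "lin d (u i) (v i) t y \<oplus> \<ominus> u i \<otimes> y d = lin d (u i) (v i) (t \<ominus> y d) y"
    proof -
      have s: "(\<Oplus>j\<in>{..<d}. v i j \<otimes> y j) \<in> carrier R"
        using v[OF i] yd by (intro finsum_closed) (auto simp: Pi_iff)
      show ?thesis unfolding lin_def using s u[OF i] t yd(1)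
        by (simp add: minus_eq r_distr l_minus r_minus a_ac)
    qed
    finally show ?thesis .
  qed
  have new: "lin (Suc d) (u' i) (v' i) t y = y d"
    if i: "\<not> i < n" and t: "t \<in> carrier R" and y: "y \<in> {..<Suc d} \<rightarrow> carrier R" for i t y
  proof -
    have "lin (Suc d) (u' i) (v' i) t y = lin d (u' i) (v' i) t y \<oplus> v' i d \<otimes> y d"
      by (rule lin_Suc[OF u'c t v'c y])
    also have "lin d (u' i) (v' i) t y = lin d \<zero> (\<lambda>_. \<zero>) t y"
      using i y unfolding u'_def by (simp, intro lin_cong) (auto simp: v'_def)
    also have "\<dots> = \<zero>"
    proof -
      have "(\<Oplus>j\<in>{..<d}. \<zero> \<otimes> y j) = \<zero>"
        using y by (intro add.finprod_one_eqI) (auto simp: Pi_iff)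
      then show ?thesis using t by (simp add: lin_def)
    qed
    also have "v' i d = \<one>" using i by (simp add: v'_def)
    finally show ?thesis using y by (simp add: Pi_iff)
  qed
  have "design (n + m) m (Suc d) u' v' b'" unfolding design_def
  proof (intro conjI allI impI ballI)
    fix t y assume t: "t \<in> carrier R - {\<zero>}" and y: "y \<in> {..<Suc d} \<rightarrow> carrier R"
    let ?S = "{i \<in> {..<n + m}. lin (Suc d) (u' i) (v' i) t y = \<zero>}"
    have yd: "y d \<in> carrier R" "y \<in> {..<d} \<rightarrow> carrier R" using y by auto
    show "card ?S \<le> n + m - m"
    \<comment> \<open>If t = y d then y d is nonzero and no new server vanishes, which leaves at
      most n. Otherwise the old bound n - m applies at t - y d, and the block adds at most
      m.\<close>
    proof (cases "t \<ominus> y d = \<zero>")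
      case True
      then have "y d \<noteq> \<zero>" using t yd by (auto simp: minus_eq)
      then have "?S \<subseteq> {..<n}" using new t y by fastforce
      then show ?thesis using card_mono[of "{..<n}" ?S] by simp
    next
      case False
      have "?S \<subseteq> {i \<in> {..<n}. lin d (u i) (v i) (t \<ominus> y d) y = \<zero>} \<union> {n..<n + m}"
        using old t y by auto
      then have "card ?S \<le> card ({i \<in> {..<n}. lin d (u i) (v i) (t \<ominus> y d) y = \<zero>} \<union> {n..<n + m})"
        by (intro card_mono) auto
      also have "\<dots> \<le> card {i \<in> {..<n}. lin d (u i) (v i) (t \<ominus> y d) y = \<zero>} + m"
        by (rule order_trans[OF card_Un_le]) simp
      also have "\<dots> \<le> (n - m) + m" using kill[of "t \<ominus> y d" y] False t yd by simp
      finally show ?thesis using mn by simp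
    qed
  next
    fix i assume i: "i < n + m"
    let ?S = "{k \<in> {..<n + m}. lin (Suc d) (u' i) (v' i) \<one> (b' k) \<noteq> \<zero>}"
    show "card ?S \<le> m"
    proof (cases "i < n")
      case True
      have "lin d (u i) (v i) (\<one> \<ominus> \<zero>) (b' k) = lin d (u i) (v i) \<one> (b k)" if "k < n" for k
        using b[OF that] v[OF True] that by (simp add: minus_eq, intro lin_cong) (auto simp: b'_def)
      \<comment> \<open>For a new dataset the old servers see the sum 1 - 1 and only zero
        coordinates, so they do not involve it.\<close>
      moreover have "lin d (u i) (v i) (\<one> \<ominus> \<one>) (b' k) = \<zero>" if "\<not> k < n" for k
      proof -
        have "(\<Oplus>j\<in>{..<d}. v i j \<otimes> b' k j) = \<zero>"
          using v[OF True] that by (intro add.finprod_one_eqI) (auto simp: b'_def Pi_iff)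
        then show ?thesis unfolding lin_def using u[OF True] by (simp add: minus_eq r_neg)
      qed
      ultimately have "?S \<subseteq> {k \<in> {..<n}. lin d (u i) (v i) \<one> (b k) \<noteq> \<zero>}"
        using old[OF True one_closed b'c] by (auto simp: b'_def split: if_splits)
      then have "card ?S \<le> card {k \<in> {..<n}. lin d (u i) (v i) \<one> (b k) \<noteq> \<zero>}"
        by (intro card_mono) auto
      then show ?thesis using load[OF True] by simp
    next
      case False
      have "?S \<subseteq> {n..<n + m}" using new[OF False one_closed b'c] by (auto simp: b'_def)
      then have "card ?S \<le> card {n..<n + m}" by (intro card_mono) auto
      then show ?thesis by simp
    qed
  qed (use u'c v'c b'c in auto)
  then show ?thesis by blast
qed

lemma design_add_blocks:
  assumes "design n m d u v b" "m \<le> n"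
  shows "\<exists>u v b. design (n + j * m) m (d + j) u v b"
proof (induction j)
  case (Suc j)
  then obtain u v b where "design (n + j * m) m (d + j) u v b" by blast
  from design_add_block[OF this] assms(2) show ?case by (simp add: add_ac)
qed (use assms in auto)

section \<open>The two planar configurations (5, 3) and (7, 4)\<close>

lemma lin_2:
  "\<lbrakk>u \<in> carrier R; t \<in> carrier R; v 0 \<in> carrier R; v 1 \<in> carrier R; y 0 \<in> carrier R; y 1 \<in> carrier R\<rbrakk>
    \<Longrightarrow> lin 2 u v t y = u \<otimes> t \<oplus> v 0 \<otimes> y 0 \<oplus> v 1 \<otimes> y 1"
  unfolding numeral_2_eq_2 by (subst lin_Suc, auto simp: less_Suc_eq)+ (simp add: lin_0)

lemma minus_eq_zero_iff:
  assumes "a \<in> carrier R" "b \<in> carrier R"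
  shows "a \<ominus> b = \<zero> \<longleftrightarrow> a = b"
proof -
  have "a = (a \<ominus> b) \<oplus> b" using assms by algebra
  then show ?thesis using assms by (auto simp: minus_eq r_neg)
qed

text \<open>Divided difference of t z^2 + p z + q at two distinct roots a and b: cancelling a - b
  leaves (a + b) t + p = 0.\<close>

lemma quadratic_difference_quotient:
  assumes "a \<otimes> a \<otimes> t \<oplus> a \<otimes> p \<oplus> q = \<zero>" "b \<otimes> b \<otimes> t \<oplus> b \<otimes> p \<oplus> q = \<zero>" "a \<noteq> b"
    and c: "a \<in> carrier R" "b \<in> carrier R" "t \<in> carrier R" "p \<in> carrier R" "q \<in> carrier R"
  shows "b \<otimes> t \<oplus> (a \<otimes> t \<oplus> p) = \<zero>"
proof -
  have "(a \<ominus> b) \<otimes> (b \<otimes> t \<oplus> (a \<otimes> t \<oplus> p))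
    = (a \<otimes> a \<otimes> t \<oplus> a \<otimes> p \<oplus> q) \<ominus> (b \<otimes> b \<otimes> t \<oplus> b \<otimes> p \<oplus> q)"
    using c by algebra
  also have "\<dots> = \<zero>" unfolding assms(1,2) by (simp add: minus_eq)
  finally show ?thesis using c assms(3) by (metis integral a_closed m_closed minus_closed minus_eq_zero_iff)
qed

text \<open>Dividing out the root a leaves an affine equation with slope t that b and c both
  satisfy.\<close>

lemma quadratic_roots_le_2:
  assumes "a \<otimes> a \<otimes> t \<oplus> a \<otimes> p \<oplus> q = \<zero>" "b \<otimes> b \<otimes> t \<oplus> b \<otimes> p \<oplus> q = \<zero>"
    "c \<otimes> c \<otimes> t \<oplus> c \<otimes> p \<oplus> q = \<zero>" "a \<noteq> b" "a \<noteq> c" "t \<noteq> \<zero>"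
    and car: "a \<in> carrier R" "b \<in> carrier R" "c \<in> carrier R" "t \<in> carrier R" "p \<in> carrier R" "q \<in> carrier R"
  shows "b = c"
  using quadratic_difference_quotient[OF assms(1,2,4)] quadratic_difference_quotient[OF assms(1,3,5)] car assms(6)
  by (intro affine_root_unique[of b t "a \<otimes> t \<oplus> p" c]) auto

lemma card_le_2I:
  assumes "\<And>i j k. \<lbrakk>i \<in> A; j \<in> A; k \<in> A; i \<noteq> j; i \<noteq> k\<rbrakk> \<Longrightarrow> j = k"
  shows "card A \<le> 2"
proof (rule ccontr)
  assume "\<not> card A \<le> 2"
  then obtain T where T: "T \<subseteq> A" "card T = 3" by (metis obtain_subset_with_card_n not_less_eq_eq eval_nat_numeral(3))
  then obtain i j k where "T = {i, j, k}" "i \<noteq> j" "i \<noteq> k" "j \<noteq> k" by (auto simp: card_3_iff)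
  with T assms show False by blast
qed

text \<open>Monic quadratics have at most two roots among the five points; the dataset types are the
  quadratics vanishing at two cyclically consecutive points.\<close>
lemma design_5_3:
  fixes x :: "nat \<Rightarrow> 'a"
  assumes x: "\<And>i. i < 5 \<Longrightarrow> x i \<in> carrier R" "inj_on x {..<5}"
  shows "\<exists>u v b. design 5 3 2 u v b"
proof -
  \<comment> \<open>With u i = x i ^ 2, the form of server i evaluates t z^2 + (y 0) z + y 1 at z =
    x i.\<close>
  define v where "v i j = (if j = (0::nat) then x i else \<one>)" for i j
  define s where "s k = (k + 1) mod (5::nat)" for k
  \<comment> \<open>Lower coefficients of (z - x k) (z - x (s k)).\<close>
  define b where "b k j = (if j = (0::nat) then \<ominus> (x k \<oplus> x (s k)) else x k \<otimes> x (s k))" for k j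
  have s5: "s k < 5" for k by (simp add: s_def)
  have lin: "lin 2 (x i \<otimes> x i) (v i) t y = x i \<otimes> x i \<otimes> t \<oplus> x i \<otimes> y 0 \<oplus> y 1"
    if "i < 5" "t \<in> carrier R" "y \<in> {..<2} \<rightarrow> carrier R" for i t y
    using that x(1) by (subst lin_2) (auto simp: v_def Pi_iff)
  have bc: "b k \<in> {..<2} \<rightarrow> carrier R" if "k < 5" for k
    using that s5 x(1) by (auto simp: b_def)
  have fac: "lin 2 (x i \<otimes> x i) (v i) \<one> (b k) = (x i \<ominus> x k) \<otimes> (x i \<ominus> x (s k))" if "i < 5" "k < 5" for i k
  proof -
    have "x i \<in> carrier R" "x k \<in> carrier R" "x (s k) \<in> carrier R" using that x(1) s5 by auto
    then show ?thesis using lin[OF that(1) one_closed bc[OF that(2)]] unfolding b_def by simp algebra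
  qed
  have "design 5 3 2 (\<lambda>i. x i \<otimes> x i) v b" unfolding design_def
  proof (intro conjI allI impI ballI)
    fix t y assume t: "t \<in> carrier R - {\<zero>}" and y: "y \<in> {..<2::nat} \<rightarrow> carrier R"
    have "card {i \<in> {..<5}. lin 2 (x i \<otimes> x i) (v i) t y = \<zero>} \<le> 2"
    proof (rule card_le_2I)
      fix i j k
      assume "i \<in> {i \<in> {..<5}. lin 2 (x i \<otimes> x i) (v i) t y = \<zero>}"
        "j \<in> {i \<in> {..<5}. lin 2 (x i \<otimes> x i) (v i) t y = \<zero>}"
        "k \<in> {i \<in> {..<5}. lin 2 (x i \<otimes> x i) (v i) t y = \<zero>}" and ne: "i \<noteq> j" "i \<noteq> k"
      then have l: "i < 5" "j < 5" "k < 5" "x i \<otimes> x i \<otimes> t \<oplus> x i \<otimes> y 0 \<oplus> y 1 = \<zero>"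
        "x j \<otimes> x j \<otimes> t \<oplus> x j \<otimes> y 0 \<oplus> y 1 = \<zero>" "x k \<otimes> x k \<otimes> t \<oplus> x k \<otimes> y 0 \<oplus> y 1 = \<zero>"
        using lin t y by auto
      have "x i \<noteq> x j" "x i \<noteq> x k" using l(1-3) ne x(2) by (auto dest: inj_onD)
      then have "x j = x k"
        using l(1-3) t y x(1) by (intro quadratic_roots_le_2[OF l(4-6)]) auto
      then show "j = k" using l(1-3) x(2) by (auto dest: inj_onD)
    qed
    then show "card {i \<in> {..<5}. lin 2 (x i \<otimes> x i) (v i) t y = \<zero>} \<le> 5 - 3" by simp
  next
    fix i :: nat assume i: "i < 5"
    let ?S = "{k \<in> {..<5}. lin 2 (x i \<otimes> x i) (v i) \<one> (b k) \<noteq> \<zero>}"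
    \<comment> \<open>Server i is a root of the quadratics of types i and i - 1; modulo 5 the latter
      is i + 4.\<close>
    have "?S \<subseteq> {..<5} - {i, (i + 4) mod 5}"
    proof
      fix k assume k: "k \<in> ?S"
      then have "(x i \<ominus> x k) \<otimes> (x i \<ominus> x (s k)) \<noteq> \<zero>" using fac i by auto
      moreover have "x i \<in> carrier R" "x k \<in> carrier R" "x (s k) \<in> carrier R" using k i x(1) s5 by auto
      ultimately have "x i \<noteq> x k" "x i \<noteq> x (s k)" by (auto simp: minus_eq r_neg)
      then have "k \<noteq> i" "s k \<noteq> i" by auto
      moreover have "s ((i + 4) mod 5) = i" using i by (auto simp: s_def mod_Suc_eq)
      ultimately show "k \<in> {..<5} - {i, (i + 4) mod 5}" using k by auto
    qed
    then have "card ?S \<le> card ({..<5} - {i, (i + 4) mod 5})" by (intro card_mono) auto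
    also have "\<dots> = 3" using i by (subst card_Diff_subset) (auto simp: card_insert_if, presburger)
    finally show "card ?S \<le> 3" .
  qed (use x(1) bc in \<open>auto simp: v_def\<close>)
  then show ?thesis by blast
qed

text \<open>In the projective plane the forms are two doubled points (types 0, 1 and 2, 3) and three
  points on a line (types 4, 5, 6). The point t lies on the line through the doubled points and on
  none of the seven lines used by the dataset types: the line of types 4, 5, 6, and the lines
  that join one of these to a doubled point.\<close>
lemma design_7_4:
  fixes x :: "nat \<Rightarrow> 'a"
  assumes x: "\<And>i. i < 3 \<Longrightarrow> x i \<in> carrier R" "inj_on x {..<3}"
  shows "\<exists>u v b. design 7 4 2 u v b"
proof -
  \<comment> \<open>In coordinates (u : v 0 : v 1) the doubled points are (x 0 : 1 : 0) and (x 1 : 1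
    : 0), and the collinear ones are w (x 2 : 1 : 0) + (0 : 0 : 1) with w = x 0, x 1, x 2. The lines
    through the two groups meet at (x 2 : 1 : 0).\<close>
  define w where "w i = x (i - 4)" for i :: nat
  define u where "u i = (if i < 2 then x 0 else if i < 4 then x 1 else w i \<otimes> x 2)" for i :: nat
  define v where "v i j = (if i < 4 then if j = (0::nat) then \<one> else \<zero> else if j = 0 then w i else \<one>)" for i j :: nat
  \<comment> \<open>Type 0 annihilates the three collinear points, types 1 to 3 the first doubled
    point and server k + 3, types 4 to 6 the second doubled point and server k.\<close>
  define b where "b k j = (if k = (0::nat) then if j = (0::nat) then \<ominus> x 2 else \<zero>
    else if k < 4 then if j = 0 then \<ominus> x 0 else x (k - 1) \<otimes> (x 0 \<ominus> x 2)
    else if j = 0 then \<ominus> x 1 else x (k - 4) \<otimes> (x 1 \<ominus> x 2))" for k j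
  have x012 [simp]: "x 0 \<in> carrier R" "x (Suc 0) \<in> carrier R" "x 2 \<in> carrier R" using x(1) by auto
  have ne: "x 0 \<noteq> x (Suc 0)" "x 0 \<noteq> x 2" "x (Suc 0) \<noteq> x 2"
    using inj_onD[OF x(2), of 0 1] inj_onD[OF x(2), of 0 2] inj_onD[OF x(2), of 1 2] by auto
  have wc: "w i \<in> carrier R" if "i < 7" for i using that x(1)[of "i - 4"] by (auto simp: w_def)
  have uc: "u i \<in> carrier R" and vc: "v i \<in> {..<2} \<rightarrow> carrier R" and bc: "b i \<in> {..<2} \<rightarrow> carrier R" if "i < 7" for i
    using that wc[OF that] x(1)[of "i - 1"] x(1)[of "i - 4"] by (auto simp: u_def v_def b_def)
  have linP: "lin 2 (u i) (v i) t y = (if i < 2 then x 0 else x 1) \<otimes> t \<oplus> y 0"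
    if "i < 4" "t \<in> carrier R" "y \<in> {..<2} \<rightarrow> carrier R" for i t y
    using that uc[of i] by (subst lin_2) (auto simp: u_def v_def Pi_iff)
  have linA: "lin 2 (u i) (v i) t y = w i \<otimes> (x 2 \<otimes> t \<oplus> y 0) \<oplus> y 1"
    if i: "4 \<le> i" "i < 7" "t \<in> carrier R" "y \<in> {..<2} \<rightarrow> carrier R" for i t y
  proof -
    have c: "w i \<in> carrier R" "y 0 \<in> carrier R" "y 1 \<in> carrier R" using that wc by (auto simp: Pi_iff)
    then have "lin 2 (u i) (v i) t y = w i \<otimes> x 2 \<otimes> t \<oplus> w i \<otimes> y 0 \<oplus> y 1"
      using that uc[of i] by (subst lin_2) (auto simp: u_def v_def Pi_iff)
    then show ?thesis using c x012(3) that(3) by (simp add: r_distr m_assoc)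
  qed
  have "design 7 4 2 u v b" unfolding design_def
  proof (intro conjI allI impI ballI)
    fix t y assume t: "t \<in> carrier R - {\<zero>}" and y: "y \<in> {..<2::nat} \<rightarrow> carrier R"
    have yc: "y 0 \<in> carrier R" "y (Suc 0) \<in> carrier R" using y by auto
    let ?S = "{i \<in> {..<7}. lin 2 (u i) (v i) t y = \<zero>}"
    have "card ?S \<le> 3"
    \<comment> \<open>If the common value x 2 t + y 0 vanishes, neither doubled point does, and only
      the three collinear servers remain. Otherwise at most one collinear server and at most one
      doubled point vanish, again at most three servers.\<close>
    proof (cases "x 2 \<otimes> t \<oplus> y 0 = \<zero>")
      case True
      have "x 0 \<otimes> t \<oplus> y 0 \<noteq> \<zero>" "x 1 \<otimes> t \<oplus> y 0 \<noteq> \<zero>"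
        using affine_root_unique[OF _ True] ne t yc by auto
      then have "\<not> i < 4" if "i \<in> ?S" for i
        using that linP[of i t y] t y by (cases "i < 2") auto
      then have "?S \<subseteq> {4..<7}" by (auto simp: not_less)
      then have "card ?S \<le> card {4..<7::nat}" by (intro card_mono) auto
      then show ?thesis by simp
    next
      case False
      let ?A = "{i \<in> {4..<7}. lin 2 (u i) (v i) t y = \<zero>}"
      have A1: "card ?A \<le> 1"
      proof (rule card_le_1I)
        fix i j assume "i \<in> ?A" "j \<in> ?A"
        then have ij: "4 \<le> i" "i < 7" "4 \<le> j" "j < 7" "w i \<otimes> (x 2 \<otimes> t \<oplus> y 0) \<oplus> y 1 = \<zero>" "w j \<otimes> (x 2 \<otimes> t \<oplus> y 0) \<oplus> y 1 = \<zero>"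
          using linA[of i t y] linA[of j t y] t y by auto
        then have "w i = w j"
          using False t yc wc by (intro affine_root_unique[OF ij(5,6)]) auto
        then have "i - 4 = j - 4" using ij unfolding w_def by (intro inj_onD[OF x(2)]) auto
        then show "i = j" using ij by simp
      qed
      have "\<exists>B. card B \<le> 2 \<and> finite B \<and> ?S \<subseteq> B \<union> ?A"
      proof (cases "x 0 \<otimes> t \<oplus> y 0 = \<zero>")
        case True
        then have "x 1 \<otimes> t \<oplus> y 0 \<noteq> \<zero>"
          using affine_root_unique[of "x 0" t "y 0" "x 1"] True ne t yc by auto
        then have "\<not> (2 \<le> i \<and> i < 4)" if "i \<in> ?S" for i
          using that linP[of i t y] t y by auto
        then have "?S \<subseteq> {..<2} \<union> ?A" by (auto simp: not_less not_le)
        then show ?thesis by (intro exI[of _ "{..<2}"]) simp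
      next
        case False
        then have "\<not> i < 2" if "i \<in> ?S" for i
          using that linP[of i t y] t y by auto
        then have "?S \<subseteq> {2..<4} \<union> ?A" by (auto simp: not_less)
        then show ?thesis by (intro exI[of _ "{2..<4}"]) simp
      qed
      then obtain B where B: "card B \<le> 2" "finite B" "?S \<subseteq> B \<union> ?A" by blast
      then have "card ?S \<le> card (B \<union> ?A)" by (intro card_mono) auto
      also have "\<dots> \<le> card B + card ?A" by (rule card_Un_le)
      finally show ?thesis using A1 B by linarith
    qed
    then show "card ?S \<le> 7 - 4" by simp
  next
    fix i :: nat assume i: "i < 7"
    let ?S = "{k \<in> {..<7}. lin 2 (u i) (v i) \<one> (b k) \<noteq> \<zero>}"
    have P0: "lin 2 (u i) (v i) \<one> (b k) = \<zero>" if "i < 2" "k \<in> {1, 2, 3}" for k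
      using linP[of i \<one> "b k"] bc[of k] that by (auto simp: b_def r_neg)
    have Q0: "lin 2 (u i) (v i) \<one> (b k) = \<zero>" if "2 \<le> i" "i < 4" "k \<in> {4, 5, 6}" for k
      using linP[of i \<one> "b k"] bc[of k] that by (auto simp: b_def r_neg)
    have A0: "lin 2 (u i) (v i) \<one> (b k) = \<zero>" if "4 \<le> i" "k \<in> {0, i - 3, i}" for k
    proof -
      have k: "k < 7" using i that by auto
      have "w i \<otimes> (x 2 \<oplus> \<ominus> x j) \<oplus> w i \<otimes> (x j \<ominus> x 2) = \<zero>" if "j < 3" for j
        using x(1)[OF that] x012(3) wc[OF i] by algebra
      from this[of 0] this[of 1] show ?thesis
        using linA[OF that(1) i one_closed bc[OF k]] that i wc[OF i] by (auto simp: b_def r_neg w_def)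
    qed
    have "\<exists>B. card B = 3 \<and> B \<subseteq> {..<7} \<and> ?S \<subseteq> {..<7} - B"
    proof -
      consider "i < 2" | "2 \<le> i" "i < 4" | "4 \<le> i" by linarith
      then show ?thesis
      proof cases
        case 1
        then show ?thesis using P0 by (intro exI[of _ "{1, 2, 3}"]) auto
      next
        case 2
        then show ?thesis using Q0 by (intro exI[of _ "{4, 5, 6}"]) auto
      next
        case 3
        then show ?thesis using A0 i by (intro exI[of _ "{0, i - 3, i}"]) auto
      qed
    qed
    then obtain B where B: "card B = 3" "B \<subseteq> {..<7::nat}" "?S \<subseteq> {..<7} - B" by blast
    have "card ?S \<le> card ({..<7} - B)" by (rule card_mono[OF _ B(3)]) simp
    also have "\<dots> = 4" using B by (subst card_Diff_subset) (auto intro: finite_subset)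
    finally show "card ?S \<le> 4" .
  qed (use uc vc bc in auto)
  then show ?thesis by blast
qed

text \<open>Each base configuration has d = h - 1, and each appended block adds one to both sides.
  Five points serve all cases: m + 1 <= 5 for the affine forms, five for the quadratics, three for
  the plane.\<close>

lemma design_exists:
  assumes x: "\<And>i. i < 5 \<Longrightarrow> x i \<in> carrier R" "inj_on x {..<5::nat}"
    and "coprime n m" "0 < m" "m \<le> n" "m \<le> 4"
  obtains d u v b where "design n m d u v b" "h n m = d + 1"
proof -
  show thesis using assms(3-6)
  proof (cases rule: coprime_small_cases)
    case one
    obtain u v b where "design (1 + (n - 1) * 1) 1 (0 + (n - 1)) u v b"
      using design_add_blocks[OF design_1_1, of "n - 1"] by auto
    then show ?thesis using that[of "n - 1" u v b] one assms(5) by (simp add: h_1_right[simplified])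
  next
    case (succ j)
    have "\<And>i. i < m + 1 \<Longrightarrow> x i \<in> carrier R" "inj_on x {..<m + 1}"
      using x assms(6) by (auto intro: inj_on_subset)
    then obtain u v b where "design n m (1 + j) u v b"
      using design_add_blocks[OF design_succ[of m x], of j] succ by auto
    then show ?thesis using that[of "1 + j" u v b] succ assms(6) h_succ_add[of m j] by simp
  next
    case (five j)
    obtain u v b where "design 5 3 2 u v b" using design_5_3[OF x] by blast
    from design_add_blocks[OF this, of j] obtain u v b where "design n m (2 + j) u v b" using five by auto
    then show ?thesis using that[of "2 + j" u v b] five h_five_add[of j] by simp
  next
    case (seven j)
    have "\<And>i. i < 3 \<Longrightarrow> x i \<in> carrier R" "inj_on x {..<3}"
      using x by (auto intro: inj_on_subset)
    then obtain u v b where "design 7 4 2 u v b" using design_7_4 by blast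
    from design_add_blocks[OF this, of j] obtain u v b where "design n m (2 + j) u v b" using seven by auto
    then show ?thesis using that[of "2 + j" u v b] seven h_seven_add[of j] by simp
  qed
qed

end

section \<open>Schemes from designs\<close>

text \<open>The decoder picks by choice any preimage of what it receives; the hypothesis makes its
  value independent of the pick.\<close>

lemma ex_decoder:
  assumes "\<And>W Q W' Q'. \<lbrakk>W \<in> A; Q \<in> B; W' \<in> A; Q' \<in> B; f W Q = f W' Q'\<rbrakk> \<Longrightarrow> g W = g W'"
  shows "\<exists>dec. \<forall>W\<in>A. \<forall>Q\<in>B. dec (f W Q) = g W"
proof -
  define dec where "dec x = g (SOME W. W \<in> A \<and> (\<exists>Q\<in>B. x = f W Q))" for x
  have "dec (f W Q) = g W" if "W \<in> A" "Q \<in> B" for W Q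
  proof -
    let ?P = "\<lambda>W'. W' \<in> A \<and> (\<exists>Q'\<in>B. f W Q = f W' Q')"
    have "?P (SOME W'. ?P W')" by (rule someI[of ?P W]) (use that in blast)
    then obtain Q' where "(SOME W'. ?P W') \<in> A" "Q' \<in> B" "f W Q = f (SOME W'. ?P W') Q'" by blast
    from assms[OF that this] show ?thesis by (simp add: dec_def)
  qed
  then show ?thesis by blast
qed

text \<open>Each run of n consecutive integers meets every residue once. Types are assigned modulo
  n, so counts of types become counts of servers or datasets.\<close>

lemma card_mod_eq:
  fixes P :: "nat \<Rightarrow> bool"
  assumes "0 < n"
  shows "card {i \<in> {1..g * n}. P (i mod n)} = g * card {i \<in> {..<n}. P i}"
proof (induction g)
  case (Suc g)
  let ?B = "{g * n + 1..g * n + n}"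
  have inj: "inj_on (\<lambda>i. i mod n) ?B"
  proof (rule linorder_inj_onI)
    fix i j assume ij: "i < j" "i \<in> ?B" "j \<in> ?B"
    show "i mod n \<noteq> j mod n"
    proof
      assume "i mod n = j mod n"
      then have "n dvd j - i" using ij by (metis mod_eq_dvd_iff_nat less_imp_le)
      then have "n \<le> j - i" using ij by (intro dvd_imp_le) auto
      then show False using ij by auto
    qed
  qed auto
  have "(\<lambda>i. i mod n) ` ?B = {..<n}"
    using assms card_image[OF inj] by (intro card_subset_eq) auto
  moreover have "inj_on (\<lambda>i. i mod n) {i \<in> ?B. P (i mod n)}" by (rule inj_on_subset[OF inj]) auto
  moreover have "(\<lambda>i. i mod n) ` {i \<in> ?B. P (i mod n)} = {y \<in> (\<lambda>i. i mod n) ` ?B. P y}" by auto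
  ultimately have "bij_betw (\<lambda>i. i mod n) {i \<in> ?B. P (i mod n)} {i \<in> {..<n}. P i}"
    by (simp add: bij_betw_def)
  then have 1: "card {i \<in> ?B. P (i mod n)} = card {i \<in> {..<n}. P i}" by (rule bij_betw_same_card)
  have "{1..Suc g * n} = {1..g * n} \<union> ?B" 
  proof -
    have "{1..n + a} = {1..a} \<union> {a + 1..a + n}" for a by auto
    then show ?thesis unfolding mult_Suc .
  qed
  then have 2: "{i \<in> {1..Suc g * n}. P (i mod n)} = {i \<in> {1..g * n}. P (i mod n)} \<union> {i \<in> ?B. P (i mod n)}"
    by blast
  have 3: "card ({i \<in> {1..g * n}. P (i mod n)} \<union> {i \<in> ?B. P (i mod n)})
      = card {i \<in> {1..g * n}. P (i mod n)} + card {i \<in> ?B. P (i mod n)}"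
  proof (rule card_Un_disjoint)
    have "{1..g * n} \<inter> ?B = {}" by simp
    then show "{i \<in> {1..g * n}. P (i mod n)} \<inter> {i \<in> ?B. P (i mod n)} = {}" by blast
  qed simp_all
  show ?case unfolding 2 3 Suc 1 by (simp only: mult_Suc add.commute)
qed simp

context field
begin

section \<open>Linearity of the forms\<close>

lemma lin_add:
  assumes "u \<in> carrier R" "v \<in> {..<d} \<rightarrow> carrier R" "t \<in> carrier R" "t' \<in> carrier R"
    "y \<in> {..<d} \<rightarrow> carrier R" "y' \<in> {..<d} \<rightarrow> carrier R"
  shows "lin d u v (t \<oplus> t') (\<lambda>j. y j \<oplus> y' j) = lin d u v t y \<oplus> lin d u v t' y'"
proof -
  have "(\<Oplus>j\<in>{..<d}. v j \<otimes> (y j \<oplus> y' j)) = (\<Oplus>j\<in>{..<d}. v j \<otimes> y j \<oplus> v j \<otimes> y' j)"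
    using assms by (intro finsum_cong') (auto simp: Pi_iff r_distr)
  also have "\<dots> = (\<Oplus>j\<in>{..<d}. v j \<otimes> y j) \<oplus> (\<Oplus>j\<in>{..<d}. v j \<otimes> y' j)"
    using assms by (intro finsum_addf) (auto simp: Pi_iff)
  moreover have "(\<Oplus>j\<in>{..<d}. v j \<otimes> y j) \<in> carrier R" "(\<Oplus>j\<in>{..<d}. v j \<otimes> y' j) \<in> carrier R"
    using assms by (auto intro!: finsum_closed simp: Pi_iff)
  ultimately show ?thesis using assms(1-4) by (simp add: lin_def r_distr a_ac)
qed

lemma lin_scale:
  assumes "u \<in> carrier R" "v \<in> {..<d} \<rightarrow> carrier R" "t \<in> carrier R" "w \<in> carrier R"
    "y \<in> {..<d} \<rightarrow> carrier R"
  shows "lin d u v (t \<otimes> w) (\<lambda>j. y j \<otimes> w) = lin d u v t y \<otimes> w"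
proof -
  have "(\<Oplus>j\<in>{..<d}. v j \<otimes> (y j \<otimes> w)) = (\<Oplus>j\<in>{..<d}. v j \<otimes> y j \<otimes> w)"
    using assms by (intro finsum_cong') (auto simp: Pi_iff m_assoc)
  also have "\<dots> = (\<Oplus>j\<in>{..<d}. v j \<otimes> y j) \<otimes> w"
    using assms by (intro finsum_ldistr[symmetric]) (auto simp: Pi_iff)
  moreover have "(\<Oplus>j\<in>{..<d}. v j \<otimes> y j) \<in> carrier R"
    using assms by (auto intro!: finsum_closed simp: Pi_iff)
  ultimately show ?thesis using assms(1,3,4) by (simp add: lin_def l_distr m_assoc)
qed

text \<open>The two views of a transmission: on the left it involves only messages with a nonzero
  coefficient, which gives locality; on the right it depends only on the sum and the masked
  combinations, which gives decoding and security.\<close>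

lemma lin_finsum:
  assumes A: "finite A" and u: "u \<in> carrier R" and v: "v \<in> {..<d} \<rightarrow> carrier R"
    and q: "q \<in> {..<d} \<rightarrow> carrier R"
    and b: "\<And>k. k \<in> A \<Longrightarrow> b k \<in> {..<d} \<rightarrow> carrier R" and w: "w \<in> A \<rightarrow> carrier R"
  shows "(\<Oplus>k\<in>A. lin d u v \<one> (b k) \<otimes> w k) \<oplus> (\<Oplus>j\<in>{..<d}. v j \<otimes> q j)
    = lin d u v (\<Oplus>k\<in>A. w k) (\<lambda>j. (\<Oplus>k\<in>A. b k j \<otimes> w k) \<oplus> q j)"
  using A b w
proof (induction A rule: finite_induct)
  case empty
  have "(\<Oplus>j\<in>{..<d}. v j \<otimes> q j) = (\<Oplus>j\<in>{..<d}. v j \<otimes> (\<zero> \<oplus> q j))"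
    using v q by (intro finsum_cong') (auto simp: Pi_iff)
  moreover have "(\<Oplus>j\<in>{..<d}. v j \<otimes> q j) \<in> carrier R" using v q by (auto intro!: finsum_closed simp: Pi_iff)
  ultimately show ?case using u by (simp add: lin_def finsum_empty)
next
  case (insert a A)
  have b: "b a \<in> {..<d} \<rightarrow> carrier R" "\<And>k. k \<in> A \<Longrightarrow> b k \<in> {..<d} \<rightarrow> carrier R"
    and w: "w a \<in> carrier R" "w \<in> A \<rightarrow> carrier R" using insert.prems by auto
  have bw: "(\<lambda>k. b k j \<otimes> w k) \<in> A \<rightarrow> carrier R" if "j < d" for j
    using b(2) w(2) that by (auto simp: Pi_iff)
  have lw: "(\<lambda>k. lin d u v \<one> (b k) \<otimes> w k) \<in> A \<rightarrow> carrier R"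
    using u v b w by (auto simp: Pi_iff intro!: m_closed lin_closed)
  have la: "lin d u v \<one> (b a) \<otimes> w a \<in> carrier R" using u v b(1) w(1) by simp
  have q': "(\<Oplus>j\<in>{..<d}. v j \<otimes> q j) \<in> carrier R" using v q by (auto intro!: finsum_closed simp: Pi_iff)
  have y: "(\<lambda>j. (\<Oplus>k\<in>A. b k j \<otimes> w k) \<oplus> q j) \<in> {..<d} \<rightarrow> carrier R"
    using bw q by (auto intro!: a_closed finsum_closed)
  have "(\<Oplus>k\<in>insert a A. lin d u v \<one> (b k) \<otimes> w k) \<oplus> (\<Oplus>j\<in>{..<d}. v j \<otimes> q j)
    = lin d u v \<one> (b a) \<otimes> w a \<oplus> ((\<Oplus>k\<in>A. lin d u v \<one> (b k) \<otimes> w k) \<oplus> (\<Oplus>j\<in>{..<d}. v j \<otimes> q j))"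
    using insert.hyps lw la q' by (simp add: finsum_insert a_assoc finsum_closed)
  also have "\<dots> = lin d u v (w a) (\<lambda>j. b a j \<otimes> w a)
      \<oplus> lin d u v (\<Oplus>k\<in>A. w k) (\<lambda>j. (\<Oplus>k\<in>A. b k j \<otimes> w k) \<oplus> q j)"
    using insert.IH[OF b(2) w(2)] lin_scale[OF u v one_closed w(1) b(1)] w(1) by simp
  also have "\<dots> = lin d u v (w a \<oplus> (\<Oplus>k\<in>A. w k)) (\<lambda>j. b a j \<otimes> w a \<oplus> ((\<Oplus>k\<in>A. b k j \<otimes> w k) \<oplus> q j))"
    by (rule lin_add[symmetric, OF u v w(1) finsum_closed[OF w(2)] _ y]) (use b(1) w(1) in auto)
  also have "\<dots> = lin d u v (\<Oplus>k\<in>insert a A. w k) (\<lambda>j. (\<Oplus>k\<in>insert a A. b k j \<otimes> w k) \<oplus> q j)"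
  proof -
    have "(\<Oplus>k\<in>insert a A. w k) = w a \<oplus> (\<Oplus>k\<in>A. w k)"
      using insert.hyps w by (simp add: finsum_insert)
    moreover have "b a j \<otimes> w a \<oplus> ((\<Oplus>k\<in>A. b k j \<otimes> w k) \<oplus> q j) = (\<Oplus>k\<in>insert a A. b k j \<otimes> w k) \<oplus> q j"
      if j: "j < d" for j
    proof -
      have "b a j \<otimes> w a \<in> carrier R" "q j \<in> carrier R" using b(1) w(1) q j by auto
      then show ?thesis using insert.hyps bw[OF j] by (simp add: finsum_insert a_assoc finsum_closed)
    qed
    moreover have "(\<lambda>j. (\<Oplus>k\<in>insert a A. b k j \<otimes> w k) \<oplus> q j) \<in> {..<d} \<rightarrow> carrier R"
      using insert.prems q by (auto intro!: a_closed finsum_closed simp: Pi_iff)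
    ultimately show ?thesis using v by (auto intro: lin_cong)
  qed
  finally show ?case .
qed

lemma lin_eq_imp_diff_zero:
  assumes c: "u \<in> carrier R" "v \<in> {..<d} \<rightarrow> carrier R" "t \<in> carrier R" "t' \<in> carrier R"
    "y \<in> {..<d} \<rightarrow> carrier R" "y' \<in> {..<d} \<rightarrow> carrier R"
    and eq: "lin d u v t y = lin d u v t' y'"
  shows "lin d u v (t \<ominus> t') (\<lambda>j. y j \<ominus> y' j) = \<zero>"
proof -
  have y: "(\<lambda>j. y j \<ominus> y' j) \<in> {..<d} \<rightarrow> carrier R" using c by auto
  have "y j = (y j \<ominus> y' j) \<oplus> y' j" if "y j \<in> carrier R" "y' j \<in> carrier R" for j
    using that by algebra
  then have "lin d u v t y = lin d u v t (\<lambda>j. (y j \<ominus> y' j) \<oplus> y' j)"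
    using c by (intro lin_cong) (auto simp: Pi_iff)
  also have "\<dots> = lin d u v ((t \<ominus> t') \<oplus> t') (\<lambda>j. (y j \<ominus> y' j) \<oplus> y' j)"
  proof -
    have "t = (t \<ominus> t') \<oplus> t'" using c(3,4) by algebra
    then show ?thesis by simp
  qed
  also have "\<dots> = lin d u v (t \<ominus> t') (\<lambda>j. y j \<ominus> y' j) \<oplus> lin d u v t' y'"
    using c y by (intro lin_add) auto
  finally have "lin d u v (t \<ominus> t') (\<lambda>j. y j \<ominus> y' j) \<oplus> lin d u v t' y' = lin d u v t' y'"
    using eq by simp
  then show ?thesis using c y by (simp add: add.r_cancel_one)
qed

end

section \<open>Message tuples and the scheme attached to a design\<close>

lemma finite_msgs: "finite (carrier F) \<Longrightarrow> finite (msgs F K L)"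
  unfolding msgs_def using finite_lists_length_eq[of "carrier F" L]
  by (intro finite_PiE) (auto simp: conj_commute)

lemma msgs_not_empty:
  assumes "x \<in> carrier F"
  shows "msgs F K L \<noteq> {}"
proof -
  have "replicate L x \<in> {xs. length xs = L \<and> set xs \<subseteq> carrier F}" using assms by auto
  then show ?thesis unfolding msgs_def PiE_eq_empty_iff by blast
qed

lemma msgs_nth: "W \<in> msgs F K L \<Longrightarrow> k \<in> {1..K} \<Longrightarrow> l < L \<Longrightarrow> W k ! l \<in> carrier F"
  unfolding msgs_def by (metis (mono_tags, lifting) PiE_mem mem_Collect_eq nth_mem subset_eq)

lemma vsum_nth: "l < L \<Longrightarrow> vsum F K L W ! l = finsum F (\<lambda>k. W k ! l) {1..K}"
  by (simp add: vsum_def)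

text \<open>In the application g = gcd(N, M') and c = K / N; servers and datasets take their types
  modulo n. With \<open>Nr\<close> as below, N - Nr + 1 = g m.\<close>

locale design_scheme = field F for F :: "'a ring" (structure) +
  fixes n m d g c L :: nat and u :: "nat \<Rightarrow> 'a" and v b :: "nat \<Rightarrow> nat \<Rightarrow> 'a"
  assumes finite_carrier: "finite (carrier F)"
    and D: "design n m d u v b"
    and mn: "0 < m" "m \<le> n" and L: "0 < L"
begin

abbreviation "N \<equiv> g * n"
abbreviation "K \<equiv> c * N"
abbreviation "Nr \<equiv> g * (n - m) + 1"

text \<open>Coefficient of message k at server i: the form of i applied to the vector (1; b
  k).\<close>

definition "coef i k = lin d (u (i mod n)) (v (i mod n)) \<one> (b (k mod n))"

definition "Z i = {k \<in> {1..K}. coef i k \<noteq> \<zero>}"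

definition "noise = {..<d} \<times> {..<L} \<rightarrow>\<^sub>E carrier F"

text \<open>Common randomness is a law on natural numbers, so noise arrays are numbered by an
  arbitrary bijection.\<close>

definition "dec_noise = (SOME e. bij_betw e {..<card noise} noise)"

definition "P = pmf_of_set {..<card noise}"

definition "\<psi> i W Q = map (\<lambda>l. (\<Oplus>k\<in>{1..K}. coef i k \<otimes> W k ! l)
   \<oplus> (\<Oplus>j\<in>{..<d}. v (i mod n) j \<otimes> dec_noise Q (j, l))) [0..<L]"

definition "masked W y l j = (\<Oplus>k\<in>{1..K}. b (k mod n) j \<otimes> W k ! l) \<oplus> y (j, l)"

lemma n_pos: "0 < n" using mn by simp

lemma type_closed: "u (i mod n) \<in> carrier F" "v (i mod n) \<in> {..<d} \<rightarrow> carrier F" "b (i mod n) \<in> {..<d} \<rightarrow> carrier F"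
  using D n_pos by (auto simp: design_def)

lemma finite_noise: "finite noise"
  using finite_carrier by (simp add: noise_def finite_PiE)

lemma noise_nonempty: "noise \<noteq> {}"
  using zero_closed by (auto simp: noise_def PiE_eq_empty_iff)

lemma card_noise_pos: "0 < card noise"
  using finite_noise noise_nonempty by (simp add: card_gt_0_iff)

lemma card_noise: "card noise = card (carrier F) ^ (d * L)"
  unfolding noise_def by (simp add: card_PiE)

lemma dec_noise: "bij_betw dec_noise {..<card noise} noise"
  unfolding dec_noise_def
  using ex_bij_betw_nat_finite[OF finite_noise] unfolding atLeast0LessThan by (rule someI_ex)

lemma set_P: "set_pmf P = {..<card noise}"
  unfolding P_def using card_noise_pos by (intro set_pmf_of_set) auto

lemma dec_noise_in: "Q \<in> set_pmf P \<Longrightarrow> dec_noise Q \<in> noise"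
  using dec_noise by (auto simp: set_P bij_betw_def)

lemma noise_nth: "y \<in> noise \<Longrightarrow> j < d \<Longrightarrow> l < L \<Longrightarrow> y (j, l) \<in> carrier F"
  by (auto simp: noise_def)

lemma masked_closed:
  assumes "W \<in> msgs F K L" "y \<in> noise" "l < L"
  shows "masked W y l \<in> {..<d} \<rightarrow> carrier F"
proof
  fix j assume "j \<in> {..<d}"
  then have j: "j < d" by simp
  have "(\<Oplus>k\<in>{1..K}. b (k mod n) j \<otimes> W k ! l) \<in> carrier F"
  proof (rule finsum_closed, rule Pi_I)
    fix k assume "k \<in> {1..K}"
    then show "b (k mod n) j \<otimes> W k ! l \<in> carrier F"
      using msgs_nth[OF assms(1) _ assms(3)] funcset_mem[OF type_closed(3)] j by simp
  qed
  then show "masked W y l j \<in> carrier F"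
    unfolding masked_def using noise_nth[OF assms(2) j assms(3)] by (rule a_closed)
qed

lemma sum_closed:
  assumes "W \<in> msgs F K L" "l < L"
  shows "(\<Oplus>k\<in>{1..K}. W k ! l) \<in> carrier F"
  using msgs_nth[OF assms(1) _ assms(2)] by (intro finsum_closed) auto

lemma psi_eq:
  assumes W: "W \<in> msgs F K L" and Q: "Q \<in> set_pmf P"
  shows "\<psi> i W Q = map (\<lambda>l. lin d (u (i mod n)) (v (i mod n)) (vsum F K L W ! l) (masked W (dec_noise Q) l)) [0..<L]"
proof -
  have "(\<Oplus>k\<in>{1..K}. coef i k \<otimes> W k ! l) \<oplus> (\<Oplus>j\<in>{..<d}. v (i mod n) j \<otimes> dec_noise Q (j, l))
    = lin d (u (i mod n)) (v (i mod n)) (\<Oplus>k\<in>{1..K}. W k ! l) (masked W (dec_noise Q) l)" if l: "l < L" for l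
    unfolding coef_def masked_def using W Q l msgs_nth[OF W _ l] noise_nth[OF dec_noise_in[OF Q]] type_closed
    by (intro lin_finsum) auto
  then show ?thesis unfolding \<psi>_def by (auto simp: vsum_nth)
qed

lemma psi_local:
  assumes W: "W \<in> msgs F K L" "W' \<in> msgs F K L" and eq: "\<forall>k\<in>Z i. W k = W' k"
  shows "\<psi> i W Q = \<psi> i W' Q"
proof -
  have "(\<Oplus>k\<in>{1..K}. coef i k \<otimes> W k ! l) = (\<Oplus>k\<in>{1..K}. coef i k \<otimes> W' k ! l)" if l: "l < L" for l
  proof (rule finsum_cong')
    fix k assume k: "k \<in> {1..K}"
    show "coef i k \<otimes> W k ! l = coef i k \<otimes> W' k ! l"
    proof (cases "k \<in> Z i")
      case False
      then have "coef i k = \<zero>" using k by (simp add: Z_def)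
      then show ?thesis using msgs_nth[OF W(1) k l] msgs_nth[OF W(2) k l] by simp
    qed (use eq in simp)
  next
    show "(\<lambda>k. coef i k \<otimes> W' k ! l) \<in> {1..K} \<rightarrow> carrier F"
      using msgs_nth[OF W(2) _ l] lin_closed[OF type_closed(1) one_closed type_closed(2,3)]
      by (auto simp: coef_def)
  qed simp
  then show ?thesis unfolding \<psi>_def by (auto intro!: map_cong)
qed

lemma card_Z: "card (Z i) \<le> c * (g * m)"
proof -
  have "card (Z i) = (c * g) * card {k \<in> {..<n}. lin d (u (i mod n)) (v (i mod n)) \<one> (b k) \<noteq> \<zero>}"
    unfolding Z_def coef_def using card_mod_eq[OF n_pos, of "c * g"] by (simp add: mult.assoc)
  also have "\<dots> \<le> (c * g) * m" using D n_pos by (intro mult_le_mono2) (auto simp: design_def)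
  finally show ?thesis by simp
qed

lemma decodable:
  assumes A: "A \<subseteq> {1..N}" "card A = Nr"
    and W: "W \<in> msgs F K L" "W' \<in> msgs F K L" and Q: "Q \<in> set_pmf P" "Q' \<in> set_pmf P"
    and eq: "\<And>i. i \<in> A \<Longrightarrow> \<psi> i W Q = \<psi> i W' Q'"
  shows "vsum F K L W = vsum F K L W'"
proof (rule nth_equalityI)
  fix l assume "l < length (vsum F K L W)"
  then have l: "l < L" by (simp add: vsum_def)
  let ?t = "vsum F K L W ! l" and ?t' = "vsum F K L W' ! l"
  let ?y = "masked W (dec_noise Q) l" and ?y' = "masked W' (dec_noise Q') l"
  have t: "?t \<in> carrier F" "?t' \<in> carrier F" using sum_closed W l by (simp_all add: vsum_nth)
  have y: "?y \<in> {..<d} \<rightarrow> carrier F" "?y' \<in> {..<d} \<rightarrow> carrier F"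
    using masked_closed W Q dec_noise_in l by auto
  let ?kill = "\<lambda>i. lin d (u i) (v i) (?t \<ominus> ?t') (\<lambda>j. ?y j \<ominus> ?y' j) = \<zero>"
  have "?kill (i mod n)" if "i \<in> A" for i
  proof -
    have "\<psi> i W Q ! l = \<psi> i W' Q' ! l" using eq[OF that] by simp
    then show ?thesis using l type_closed t y
      by (intro lin_eq_imp_diff_zero) (simp_all add: psi_eq[OF W(1) Q(1)] psi_eq[OF W(2) Q(2)])
  qed
  then have "A \<subseteq> {i \<in> {1..N}. ?kill (i mod n)}" using A by auto
  then have "Nr \<le> card {i \<in> {1..N}. ?kill (i mod n)}" unfolding A(2)[symmetric] by (intro card_mono) auto
  also have "\<dots> = g * card {i \<in> {..<n}. ?kill i}" by (rule card_mod_eq[OF n_pos])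
  \<comment> \<open>The summand 1 in \<open>Nr\<close> makes the inequality strict, so some n types
    have more than n - m vanishing forms, contrary to the design unless the sums agree.\<close>
  finally have "g * (n - m) < g * card {i \<in> {..<n}. ?kill i}" by (simp only: Suc_eq_plus1[symmetric] Suc_le_eq)
  then have big: "n - m < card {i \<in> {..<n}. ?kill i}" by (simp only: mult_less_cancel1)
  show "?t = ?t'"
  proof (rule ccontr)
    assume "?t \<noteq> ?t'"
    then have "?t \<ominus> ?t' \<in> carrier F - {\<zero>}" using t minus_eq_zero_iff by auto
    moreover have "(\<lambda>j. ?y j \<ominus> ?y' j) \<in> {..<d} \<rightarrow> carrier F" using y by auto
    ultimately have "card {i \<in> {..<n}. ?kill i} \<le> n - m" using D unfolding design_def by blast
    with big show False by simp
  qed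
qed (simp add: vsum_def)

text \<open>One-time pad: for fixed messages, masking translates the noise, so the masked
  combinations are uniform whatever the messages are.\<close>

lemma masked_bij:
  assumes W: "W \<in> msgs F K L"
  shows "bij_betw (\<lambda>y. \<lambda>(j, l)\<in>{..<d} \<times> {..<L}. masked W y l j) noise noise"
proof -
  let ?f = "\<lambda>y. \<lambda>(j, l)\<in>{..<d} \<times> {..<L}. masked W y l j"
  have inj: "inj_on ?f noise"
  proof (rule inj_onI)
    fix y y' assume y: "y \<in> noise" "y' \<in> noise" and eq: "?f y = ?f y'"
    show "y = y'"
    proof (rule PiE_ext[OF y[unfolded noise_def]])
      fix p assume p: "p \<in> {..<d} \<times> {..<L}"
      then obtain j l where jl: "p = (j, l)" "j < d" "l < L" by (cases p) auto
      let ?s = "\<Oplus>k\<in>{1..K}. b (k mod n) j \<otimes> W k ! l"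
      have s: "?s \<in> carrier F"
      proof (rule finsum_closed, rule Pi_I)
        fix k assume "k \<in> {1..K}"
        then show "b (k mod n) j \<otimes> W k ! l \<in> carrier F"
          using msgs_nth[OF W _ jl(3)] funcset_mem[OF type_closed(3)] jl(2) by simp
      qed
      note c = noise_nth[OF y(1) jl(2,3)] noise_nth[OF y(2) jl(2,3)]
      have "?f y p = ?f y' p" by (rule fun_cong[OF eq, of p])
      then have "?s \<oplus> y (j, l) = ?s \<oplus> y' (j, l)" using jl by (simp add: masked_def)
      then have "y (j, l) \<oplus> ?s = y' (j, l) \<oplus> ?s" unfolding a_comm[OF s c(1)] a_comm[OF s c(2)] .
      then show "y p = y' p" using add.right_cancel[OF s c] jl(1) by simp
    qed
  qed
  moreover have "?f ` noise \<subseteq> noise"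
  proof
    fix z assume "z \<in> ?f ` noise"
    then obtain y where y: "y \<in> noise" "z = ?f y" by blast
    show "z \<in> noise" unfolding y(2) noise_def using masked_closed[OF W y(1)] by (intro restrict_PiE_iff[THEN iffD2]) (auto simp: Pi_iff)
  qed
  ultimately show ?thesis using endo_inj_surj[OF finite_noise] by (simp add: bij_betw_def)
qed

lemma secure:
  "cmi (real (card (carrier F))) (pair_pmf (pmf_of_set (msgs F K L)) P)
     fst (\<lambda>(W, Q). (\<lambda>i\<in>{1..N}. \<psi> i W Q)) (\<lambda>(W, Q). vsum F K L W) = 0"
proof -
  \<comment> \<open>The transcript as a function of the sum and the masked combinations only; its
    law under uniform noise is the required kernel.\<close>
  define G where "G s y = (\<lambda>i\<in>{1..N}. map (\<lambda>l. lin d (u (i mod n)) (v (i mod n)) (s ! l) (\<lambda>j. y (j, l))) [0..<L])"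
    for s :: "'a list" and y :: "nat \<times> nat \<Rightarrow> 'a"
  let ?M = "msgs F K L"
  have M: "finite ?M" "?M \<noteq> {}" using finite_msgs[OF finite_carrier] msgs_not_empty[OF zero_closed] by auto
  have q: "1 < card (carrier F)"
    using finite_carrier card_mono[of "carrier F" "{\<zero>, \<one>}"] by simp
  have "cmi (real (card (carrier F))) (pair_pmf (pmf_of_set ?M) P)
     fst (\<lambda>(W, Q). (\<lambda>i\<in>{1..N}. \<psi> i W Q)) (\<lambda>z. vsum F K L (fst z)) = 0"
  proof (rule cmi_eq_0_if_law_factors[where \<kappa> = "\<lambda>s. map_pmf (G s) (pmf_of_set noise)"])
    fix W assume "W \<in> set_pmf (pmf_of_set ?M)"
    then have W: "W \<in> ?M" using M by simp
    let ?f = "\<lambda>y. \<lambda>(j, l)\<in>{..<d} \<times> {..<L}. masked W y l j"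
    have "map_pmf (\<lambda>Q. case (W, Q) of (W, Q) \<Rightarrow> \<lambda>i\<in>{1..N}. \<psi> i W Q) P
      = map_pmf (\<lambda>Q. G (vsum F K L W) (?f (dec_noise Q))) P"
    proof (rule map_pmf_cong[OF refl])
      fix Q assume Q: "Q \<in> set_pmf P"
      have "lin d (u (i mod n)) (v (i mod n)) (vsum F K L W ! l) (masked W (dec_noise Q) l)
        = lin d (u (i mod n)) (v (i mod n)) (vsum F K L W ! l) (\<lambda>j. ?f (dec_noise Q) (j, l))" if "l < L" for i l
        using that type_closed masked_closed[OF W dec_noise_in[OF Q] that]
        by (intro lin_cong) auto
      then show "(case (W, Q) of (W, Q) \<Rightarrow> \<lambda>i\<in>{1..N}. \<psi> i W Q) = G (vsum F K L W) (?f (dec_noise Q))"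
        unfolding G_def prod.case by (intro restrict_ext) (simp add: psi_eq[OF W Q])
    qed
    also have "\<dots> = map_pmf (G (vsum F K L W)) (map_pmf ?f (map_pmf dec_noise P))"
      by (simp add: map_pmf_comp)
    also have "map_pmf dec_noise P = pmf_of_set noise"
      unfolding P_def using card_noise_pos by (intro map_pmf_of_set_bij_betw dec_noise) auto
    also have "map_pmf ?f (pmf_of_set noise) = pmf_of_set noise"
      by (intro map_pmf_of_set_bij_betw masked_bij W noise_nonempty finite_noise)
    finally show "map_pmf (\<lambda>Q. case (W, Q) of (W, Q) \<Rightarrow> \<lambda>i\<in>{1..N}. \<psi> i W Q) P
      = map_pmf (G (vsum F K L W)) (pmf_of_set noise)" .
  qed (use M q set_P in auto)
  then show ?thesis by (simp add: case_prod_unfold)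
qed

lemma secure_scheme: "secure_scheme F K N Nr (c * (g * m)) L Z P \<psi> (\<lambda>_. L)"
  unfolding secure_scheme_def
proof (intro conjI)
  show "\<forall>i\<in>{1..N}. Z i \<subseteq> {1..K} \<and> card (Z i) \<le> c * (g * m)"
    using card_Z by (auto simp: Z_def)
  show "finite (set_pmf P)" by (simp add: set_P)
  show "\<forall>i\<in>{1..N}. \<forall>W\<in>msgs F K L. \<forall>W'\<in>msgs F K L. \<forall>Q\<in>set_pmf P.
      (\<forall>k\<in>Z i. W k = W' k) \<longrightarrow> \<psi> i W Q = \<psi> i W' Q"
    using psi_local by blast
  show "\<forall>i\<in>{1..N}. \<forall>W\<in>msgs F K L. \<forall>Q\<in>set_pmf P. length (\<psi> i W Q) = L \<and> set (\<psi> i W Q) \<subseteq> carrier F"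
  proof (intro ballI)
    fix i W Q assume W: "W \<in> msgs F K L" and Q: "Q \<in> set_pmf P"
    show "length (\<psi> i W Q) = L \<and> set (\<psi> i W Q) \<subseteq> carrier F"
      unfolding psi_eq[OF W Q]
      using lin_closed[OF type_closed(1) _ type_closed(2) masked_closed[OF W dec_noise_in[OF Q]]] sum_closed[OF W]
      by (auto simp: vsum_nth)
  qed
  show "\<forall>A. A \<subseteq> {1..N} \<and> card A = Nr \<longrightarrow>
        (\<exists>dec :: (nat \<Rightarrow> 'a list) \<Rightarrow> 'a list.
           \<forall>W\<in>msgs F K L. \<forall>Q\<in>set_pmf P. dec (\<lambda>i\<in>A. \<psi> i W Q) = vsum F K L W)"
  proof (intro allI impI)
    fix A assume A: "A \<subseteq> {1..N} \<and> card A = Nr"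
    show "\<exists>dec :: (nat \<Rightarrow> 'a list) \<Rightarrow> 'a list.
           \<forall>W\<in>msgs F K L. \<forall>Q\<in>set_pmf P. dec (\<lambda>i\<in>A. \<psi> i W Q) = vsum F K L W"
    proof (rule ex_decoder[where f = "\<lambda>W Q. \<lambda>i\<in>A. \<psi> i W Q" and g = "vsum F K L"])
      fix W Q W' Q'
      assume *: "W \<in> msgs F K L" "Q \<in> set_pmf P" "W' \<in> msgs F K L" "Q' \<in> set_pmf P"
        "(\<lambda>i\<in>A. \<psi> i W Q) = (\<lambda>i\<in>A. \<psi> i W' Q')"
      show "vsum F K L W = vsum F K L W'"
      proof (rule decodable[of A])
        fix i assume "i \<in> A"
        then show "\<psi> i W Q = \<psi> i W' Q'" using fun_cong[OF *(5), of i] by simp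
      qed (use A * in auto)
    qed
  qed
  show "cmi (real (card (carrier F))) (pair_pmf (pmf_of_set (msgs F K L)) P)
     fst (\<lambda>(W, Q). (\<lambda>i\<in>{1..N}. \<psi> i W Q)) (\<lambda>(W, Q). vsum F K L W) = 0"
    by (rule secure)
qed

lemma rand_size: "rand_size F L P = real d"
proof -
  have q: "1 < card (carrier F)"
    using finite_carrier card_mono[of "carrier F" "{\<zero>, \<one>}"] by simp
  have "ent (real (card (carrier F))) P = log (real (card (carrier F))) (real (card noise))"
    unfolding P_def using card_noise_pos by (subst ent_pmf_of_set) auto
  also have "\<dots> = real (d * L)" using q unfolding card_noise by (simp add: log_nat_power)
  finally show ?thesis using L by (simp add: rand_size_def)
qed

end

section \<open>Lower bounds for secure schemes\<close>

lemma card_vectors: "finite (carrier F) \<Longrightarrow> card {xs. length xs = L \<and> set xs \<subseteq> carrier F} = card (carrier F) ^ L"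
  using card_lists_length_eq[of "carrier F" L] by (simp add: conj_commute)

lemma finite_vectors: "finite (carrier F) \<Longrightarrow> finite {xs. length xs = L \<and> set xs \<subseteq> carrier F}"
  using finite_lists_length_eq[of "carrier F" L] by (simp add: conj_commute)

lemma card_msgs: "finite (carrier F) \<Longrightarrow> card (msgs F K L) = card (carrier F) ^ (L * K)"
  by (simp add: msgs_def card_PiE card_vectors power_mult)

lemma msgs_upd:
  "\<lbrakk>W \<in> msgs F K L; k \<in> {1..K}; length x = L; set x \<subseteq> carrier F\<rbrakk> \<Longrightarrow> W(k := x) \<in> msgs F K L"
  unfolding msgs_def by (auto simp: PiE_iff extensional_def)

lemma msgs_component:
  "\<lbrakk>W \<in> msgs F K L; k \<in> {1..K}\<rbrakk> \<Longrightarrow> length (W k) = L \<and> set (W k) \<subseteq> carrier F"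
  unfolding msgs_def by (auto simp: PiE_iff)

lemma vsum_in: 
  assumes "abelian_monoid F" "W \<in> msgs F K L"
  shows "vsum F K L W \<in> {xs. length xs = L \<and> set xs \<subseteq> carrier F}"
proof -
  have "finsum F (\<lambda>k. W k ! l) {1..K} \<in> carrier F" if "l < L" for l
    using msgs_nth[OF assms(2) _ that] by (intro abelian_monoid.finsum_closed[OF assms(1)]) auto
  then show ?thesis by (auto simp: vsum_def)
qed

locale scheme = field F for F :: "'a ring" (structure) +
  fixes K N Nr L :: nat and Z :: "nat \<Rightarrow> nat set" and P :: "nat pmf"
    and \<psi> :: "nat \<Rightarrow> (nat \<Rightarrow> 'a list) \<Rightarrow> nat \<Rightarrow> 'a list" and T :: "nat \<Rightarrow> nat"
  assumes finite_carrier: "finite (carrier F)" and L: "0 < L" and K: "0 < K"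
    and Nr: "0 < Nr" "Nr \<le> N" and dvd: "N dvd K"
    and scheme: "secure_scheme F K N Nr (K div N * (N - Nr + 1)) L Z P \<psi> T"
begin

abbreviation "q \<equiv> card (carrier F)"
abbreviation "M \<equiv> K div N * (N - Nr + 1)"
abbreviation "M' \<equiv> N - Nr + 1"

lemma q_gt_1: "1 < q"
  using finite_carrier card_mono[of "carrier F" "{\<zero>, \<one>}"] by simp

lemmas scheme_parts = scheme[unfolded secure_scheme_def]

lemma Z_subset: "n \<in> {1..N} \<Longrightarrow> Z n \<subseteq> {1..K}"
  and card_Z_le: "n \<in> {1..N} \<Longrightarrow> card (Z n) \<le> M"
  using scheme_parts[THEN conjunct1] by simp_all

lemma finite_P: "finite (set_pmf P)"
  using scheme_parts[THEN conjunct2, THEN conjunct1] .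

lemma psi_local:
  "\<lbrakk>n \<in> {1..N}; W \<in> msgs F K L; W' \<in> msgs F K L; Q \<in> set_pmf P; \<And>k. k \<in> Z n \<Longrightarrow> W k = W' k\<rbrakk>
     \<Longrightarrow> \<psi> n W Q = \<psi> n W' Q"
  by (rule scheme_parts[THEN conjunct2, THEN conjunct2, THEN conjunct1, THEN bspec, THEN bspec, THEN bspec,
        THEN bspec, THEN mp]) auto

lemma psi_closed:
  "\<lbrakk>n \<in> {1..N}; W \<in> msgs F K L; Q \<in> set_pmf P\<rbrakk>
     \<Longrightarrow> length (\<psi> n W Q) = T n \<and> set (\<psi> n W Q) \<subseteq> carrier F"
  using scheme_parts[THEN conjunct2, THEN conjunct2, THEN conjunct2, THEN conjunct1] by simp

lemma decodable:
  assumes "A \<subseteq> {1..N}" "card A = Nr" "W \<in> msgs F K L" "W' \<in> msgs F K L" "Q \<in> set_pmf P"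
    and eq: "\<And>n. n \<in> A \<Longrightarrow> \<psi> n W Q = \<psi> n W' Q"
  shows "vsum F K L W = vsum F K L W'"
proof -
  obtain dec :: "(nat \<Rightarrow> 'a list) \<Rightarrow> 'a list" where
    dec: "\<forall>W\<in>msgs F K L. \<forall>Q\<in>set_pmf P. dec (\<lambda>n\<in>A. \<psi> n W Q) = vsum F K L W"
    using scheme_parts[THEN conjunct2, THEN conjunct2, THEN conjunct2, THEN conjunct2, THEN conjunct1] assms(1,2)
    by blast
  have "(\<lambda>n\<in>A. \<psi> n W Q) = (\<lambda>n\<in>A. \<psi> n W' Q)" using eq by (intro restrict_ext) auto
  then show ?thesis using dec assms(3-5) by metis
qed

lemma vsum_inj_component:
  assumes W: "W \<in> msgs F K L" "W' \<in> msgs F K L" and k: "k \<in> {1..K}"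
    and off: "\<And>k'. k' \<noteq> k \<Longrightarrow> W k' = W' k'" and eq: "vsum F K L W = vsum F K L W'"
  shows "W k = W' k"
proof (rule nth_equalityI)
  show "length (W k) = length (W' k)" using msgs_component W k by metis
  fix l assume "l < length (W k)"
  then have l: "l < L" using msgs_component[OF W(1) k] by simp
  let ?r = "\<lambda>W. finsum F (\<lambda>k. W k ! l) ({1..K} - {k})"
  have split: "finsum F (\<lambda>k. V k ! l) {1..K} = V k ! l \<oplus> ?r V" if "V \<in> msgs F K L" for V
    using finsum_insert[of "{1..K} - {k}" k "\<lambda>k. V k ! l"] msgs_nth[OF that _ l] k
    by (simp add: insert_absorb Pi_iff)
  have "?r W = ?r W'" using msgs_nth[OF W(2) _ l] off by (intro finsum_cong') auto
  moreover have "?r W' \<in> carrier F" using msgs_nth[OF W(2) _ l] by (intro finsum_closed) auto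
  moreover have "W k ! l \<oplus> ?r W = W' k ! l \<oplus> ?r W'"
    using eq l split[OF W(1)] split[OF W(2)] by (metis vsum_nth)
  ultimately show "W k ! l = W' k ! l"
    using msgs_nth[OF W(1) k l] msgs_nth[OF W(2) k l] by simp
qed

text \<open>Servers of \<open>A\<close> that do not hold k cannot notice the change, so agreement of
  the holders already forces equal decoded sums, which differ only through message k.\<close>

lemma component_determined:
  assumes A: "A \<subseteq> {1..N}" "card A = Nr" and W: "W \<in> msgs F K L" "W' \<in> msgs F K L"
    and Q: "Q \<in> set_pmf P" and k: "k \<in> {1..K}" and off: "\<And>k'. k' \<noteq> k \<Longrightarrow> W k' = W' k'"
    and eq: "\<And>n. n \<in> A \<Longrightarrow> k \<in> Z n \<Longrightarrow> \<psi> n W Q = \<psi> n W' Q"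
  shows "W k = W' k"
proof (rule vsum_inj_component[OF W k off])
  show "vsum F K L W = vsum F K L W'"
  proof (rule decodable[OF A W Q])
    fix n assume n: "n \<in> A"
    show "\<psi> n W Q = \<psi> n W' Q"
    proof (cases "k \<in> Z n")
      case False
      show ?thesis
      proof (rule psi_local[OF _ W Q])
        show "n \<in> {1..N}" using n A by blast
        fix k' assume "k' \<in> Z n"
        with False have "k' \<noteq> k" by blast
        then show "W k' = W' k'" by (rule off)
      qed
    qed (rule eq[OF n])
  qed
qed

text \<open>With fewer holders, some Nr servers would all miss k and yet decode a sum that depends
  on it.\<close>

lemma card_holders_ge:
  assumes k: "k \<in> {1..K}"
  shows "M' \<le> card {n \<in> {1..N}. k \<in> Z n}"
proof (rule ccontr)
  let ?S = "{n \<in> {1..N}. k \<in> Z n}"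
  assume "\<not> ?thesis"
  moreover have "card ({1..N} - ?S) = N - card ?S" by (subst card_Diff_subset) auto
  ultimately have "Nr \<le> card ({1..N} - ?S)" using Nr by simp
  then obtain A where A: "A \<subseteq> {1..N} - ?S" "card A = Nr" by (metis obtain_subset_with_card_n)
  obtain W where W: "W \<in> msgs F K L" using msgs_not_empty[OF zero_closed] by blast
  obtain Q where Q: "Q \<in> set_pmf P" using set_pmf_not_empty by fast
  let ?V = "\<lambda>x. W(k := replicate L x)"
  have V: "?V x \<in> msgs F K L" if "x \<in> carrier F" for x using msgs_upd[OF W k, of "replicate L x"] that by (auto simp: set_replicate_conv_if)
  have "?V \<zero> k = ?V \<one> k"
    by (rule component_determined[of A "?V \<zero>" "?V \<one>" Q k]) (use A V Q k in auto)
  then show False using L by (simp add: replicate_eq_replicate)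
qed

lemma K_eq: "K = K div N * N" using dvd by simp

lemma M_pos: "0 < M"
  using K K_eq by (metis Suc_eq_plus1 gr0I mult_0 mult_is_0 nat.simps(3))

text \<open>Counting incidences by datasets gives at least K M', by servers at most N M. The two
  bounds are equal, so every term is extremal.\<close>

lemma
  shows card_Z: "n \<in> {1..N} \<Longrightarrow> card (Z n) = M"
    and card_holders: "k \<in> {1..K} \<Longrightarrow> card {n \<in> {1..N}. k \<in> Z n} = M'"
proof -
  have "(\<Sum>k\<in>{1..K}. card {n \<in> {1..N}. k \<in> Z n}) = (\<Sum>n\<in>{1..N}. card {k \<in> {1..K}. k \<in> Z n})"
    by (rule sum_multicount_gen) auto
  also have "\<dots> = (\<Sum>n\<in>{1..N}. card (Z n))"
  proof (rule sum.cong[OF refl])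
    fix n assume "n \<in> {1..N}"
    then have "{k \<in> {1..K}. k \<in> Z n} = Z n" using Z_subset by blast
    then show "card {k \<in> {1..K}. k \<in> Z n} = card (Z n)" by simp
  qed
  finally have swap: "(\<Sum>k\<in>{1..K}. card {n \<in> {1..N}. k \<in> Z n}) = (\<Sum>n\<in>{1..N}. card (Z n))" .
  have lo: "(\<Sum>k\<in>{1..K}. M') \<le> (\<Sum>k\<in>{1..K}. card {n \<in> {1..N}. k \<in> Z n})"
    by (intro sum_mono card_holders_ge)
  have hi: "(\<Sum>n\<in>{1..N}. card (Z n)) \<le> (\<Sum>n\<in>{1..N}. M)"
    by (intro sum_mono card_Z_le)
  have "N * M = (K div N * N) * M'" by (simp only: mult_ac)
  then have "N * M = K * M'" unfolding K_eq[symmetric] .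
  then have tot: "(\<Sum>k\<in>{1..K}. M') = (\<Sum>n\<in>{1..N}. M)" by simp
  show "card (Z n) = M" if "n \<in> {1..N}"
    by (rule sum_mono_inv[OF _ card_Z_le that]) (use lo hi tot swap in linarith, auto)
  show "card {n \<in> {1..N}. k \<in> Z n} = M'" if "k \<in> {1..K}"
    by (rule sum_mono_inv[OF _ card_holders_ge that, symmetric]) (use lo hi tot swap in linarith, auto)
qed

sublocale cover: uniform_cover "{1..N}" "{1..K}" Z M M'
  using Z_subset card_Z card_holders M_pos by unfold_locales auto

text \<open>Exactly N - M' = Nr - 1 servers miss k; together with n they form a decoding set in
  which n is the only holder of k.\<close>

lemma transmission_determines:
  assumes n: "n \<in> {1..N}" and k: "k \<in> Z n" and W: "W \<in> msgs F K L" "W' \<in> msgs F K L"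
    and Q: "Q \<in> set_pmf P" and off: "\<And>k'. k' \<noteq> k \<Longrightarrow> W k' = W' k'"
    and eq: "\<psi> n W Q = \<psi> n W' Q"
  shows "W k = W' k"
proof -
  let ?S = "{n \<in> {1..N}. k \<in> Z n}" and ?A = "insert n {n \<in> {1..N}. k \<notin> Z n}"
  have kK: "k \<in> {1..K}" using k n Z_subset by blast
  have "{n \<in> {1..N}. k \<notin> Z n} = {1..N} - ?S" by auto
  moreover have "card ({1..N} - ?S) = N - card ?S" by (subst card_Diff_subset) auto
  ultimately have "card {n \<in> {1..N}. k \<notin> Z n} = N - M'" using card_holders[OF kK] by simp
  then have "card ?A = Nr" using k Nr by simp
  then show ?thesis by (intro component_determined[of ?A W W' Q k]) (use n W Q kK off eq in auto)
qed

text \<open>Varying one message that n holds embeds F^L into F^(T n).\<close>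

lemma T_ge:
  assumes n: "n \<in> {1..N}"
  shows "L \<le> T n"
proof -
  have "Z n \<noteq> {}" using card_Z[OF n] M_pos by auto
  then obtain k where k: "k \<in> Z n" by blast
  then have kK: "k \<in> {1..K}" using n Z_subset by blast
  obtain W where W: "W \<in> msgs F K L" using msgs_not_empty[OF zero_closed] by blast
  obtain Q where Q: "Q \<in> set_pmf P" using set_pmf_not_empty by fast
  let ?V = "\<lambda>L. {xs. length xs = L \<and> set xs \<subseteq> carrier F}"
  have upd: "W(k := x) \<in> msgs F K L" if "x \<in> ?V L" for x using msgs_upd[OF W kK] that by auto
  have "inj_on (\<lambda>x. \<psi> n (W(k := x)) Q) (?V L)"
  proof (rule inj_onI)
    fix x y assume xy: "x \<in> ?V L" "y \<in> ?V L" "\<psi> n (W(k := x)) Q = \<psi> n (W(k := y)) Q"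
    have "(W(k := x)) k = (W(k := y)) k"
      by (rule transmission_determines[OF n k upd[OF xy(1)] upd[OF xy(2)] Q _ xy(3)]) simp
    then show "x = y" by simp
  qed
  moreover have "(\<lambda>x. \<psi> n (W(k := x)) Q) ` ?V L \<subseteq> ?V (T n)"
    using psi_closed[OF n upd Q] by blast
  ultimately have "card (?V L) \<le> card (?V (T n))"
    by (rule card_inj_on_le) (rule finite_vectors[OF finite_carrier])
  then show ?thesis using q_gt_1 by (simp add: card_vectors[OF finite_carrier])
qed

lemma comm_cost_ge: "real Nr \<le> comm_cost N Nr L T"
proof -
  let ?C = "{\<Sum>n\<in>A. T n | A. A \<subseteq> {1..N} \<and> card A = Nr}"
  obtain A where A: "A \<subseteq> {1..N}" "card A = Nr"
    using obtain_subset_with_card_n[of Nr "{1..N}"] Nr by auto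
  have "?C \<subseteq> sum T ` Pow {1..N}" by auto
  then have fin: "finite ?C" by (rule finite_subset) simp
  have "Nr * L = (\<Sum>n\<in>A. L)" using A by simp
  also have "\<dots> \<le> (\<Sum>n\<in>A. T n)" by (intro sum_mono T_ge) (use A in blast)
  also have "\<dots> \<le> Max ?C"
  proof (rule Max_ge[OF fin])
    show "(\<Sum>n\<in>A. T n) \<in> ?C" using A by blast
  qed
  finally have "real (Nr * L) \<le> real (Max ?C)" by (simp only: of_nat_le_iff)
  then have "real Nr * real L \<le> real (Max ?C)" by simp
  then show ?thesis using L by (simp add: comm_cost_def pos_le_divide_eq)
qed

text \<open>Triangular elimination: \<open>D\<close> contains one fresh dataset per server. The
  datasets chosen later avoid \<open>Z n\<close>, so the first server sees only its own unknown,
  which it determines; the rest of the chain follows by induction.\<close>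

lemma chain_determines:
  assumes "set ns \<subseteq> {1..N}" "fresh_chain Z U ns" and Q: "Q \<in> set_pmf P"
  shows "\<exists>D. D \<subseteq> {1..K} - U \<and> card D = length ns \<and>
    (\<forall>W\<in>msgs F K L. \<forall>W'\<in>msgs F K L. (\<forall>k. k \<notin> D \<longrightarrow> W k = W' k) \<longrightarrow>
       (\<forall>n\<in>set ns. \<psi> n W Q = \<psi> n W' Q) \<longrightarrow> W = W')"
  using assms(1,2)
proof (induction ns arbitrary: U)
  case Nil
  then show ?case by (intro exI[of _ "{}"]) auto
next
  case (Cons n ns)
  then have n: "n \<in> {1..N}" by simp
  obtain k where k: "k \<in> Z n" "k \<notin> U" using Cons.prems by auto
  then have kK: "k \<in> {1..K}" using n Z_subset by blast
  have "\<exists>D. D \<subseteq> {1..K} - (U \<union> Z n) \<and> card D = length ns \<and>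
    (\<forall>W\<in>msgs F K L. \<forall>W'\<in>msgs F K L. (\<forall>k. k \<notin> D \<longrightarrow> W k = W' k) \<longrightarrow>
       (\<forall>n\<in>set ns. \<psi> n W Q = \<psi> n W' Q) \<longrightarrow> W = W')"
    by (rule Cons.IH) (use Cons.prems in simp_all)
  then obtain D where D: "D \<subseteq> {1..K} - (U \<union> Z n)" "card D = length ns"
    and det0: "\<forall>W\<in>msgs F K L. \<forall>W'\<in>msgs F K L. (\<forall>k. k \<notin> D \<longrightarrow> W k = W' k) \<longrightarrow>
       (\<forall>n\<in>set ns. \<psi> n W Q = \<psi> n W' Q) \<longrightarrow> W = W'"
    by (elim exE conjE)
  note det = det0[THEN bspec, THEN bspec, THEN mp, THEN mp]
  have kD: "k \<notin> D" and finD: "finite D" using D k by (auto intro: finite_subset)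
  have "W = W'" if W: "W \<in> msgs F K L" "W' \<in> msgs F K L" and off: "\<forall>k'. k' \<notin> insert k D \<longrightarrow> W k' = W' k'"
    and eq: "\<forall>n\<in>set (n # ns). \<psi> n W Q = \<psi> n W' Q" for W W'
  proof -
    \<comment> \<open>On \<open>Z n\<close> this hybrid agrees with W', and it differs from W at
      most in message k.\<close>
    let ?W = "W(k := W' k)"
    have V: "?W \<in> msgs F K L" using msgs_upd[OF W(1) kK] msgs_component[OF W(2) kK] by simp
    have "\<psi> n ?W Q = \<psi> n W' Q"
      by (rule psi_local[OF n V W(2) Q]) (use off D in auto)
    then have "W k = ?W k"
      using eq by (intro transmission_determines[OF n k(1) W(1) V Q]) auto
    then show ?thesis using off eq by (intro det W) auto
  qed
  then show ?case using D k kK kD finD by (intro exI[of _ "insert k D"]) auto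
qed

text \<open>Within a fibre the messages outside \<open>D\<close> determine the others, so a fibre
  embeds into the tuples indexed by the K - length ns remaining datasets.\<close>

lemma card_fibre_le:
  assumes ns: "set ns \<subseteq> {1..N}" "fresh_chain Z {} ns" and Q: "Q \<in> set_pmf P"
  shows "card {W \<in> msgs F K L. (\<lambda>n\<in>{1..N}. \<psi> n W Q) = x} * q ^ (length ns * L) \<le> card (msgs F K L)"
proof -
  obtain D where D: "D \<subseteq> {1..K}" "card D = length ns"
    and det0: "\<forall>W\<in>msgs F K L. \<forall>W'\<in>msgs F K L. (\<forall>k. k \<notin> D \<longrightarrow> W k = W' k) \<longrightarrow>
       (\<forall>n\<in>set ns. \<psi> n W Q = \<psi> n W' Q) \<longrightarrow> W = W'"
    using chain_determines[OF ns Q] unfolding Diff_empty by (elim exE conjE)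
  note det = det0[THEN bspec, THEN bspec, THEN mp, THEN mp]
  let ?B = "{W \<in> msgs F K L. (\<lambda>n\<in>{1..N}. \<psi> n W Q) = x}"
  let ?R = "\<lambda>W. restrict W ({1..K} - D)"
  let ?V = "{xs. length xs = L \<and> set xs \<subseteq> carrier F}"
  have "inj_on ?R ?B"
  proof (rule inj_onI)
    fix W W' assume W: "W \<in> ?B" "W' \<in> ?B" and eq: "?R W = ?R W'"
    show "W = W'"
    proof (rule det)
      show "\<forall>k. k \<notin> D \<longrightarrow> W k = W' k"
      proof (intro allI impI)
        fix k assume k: "k \<notin> D"
        show "W k = W' k"
        proof (cases "k \<in> {1..K}")
          case True
          then show ?thesis using k fun_cong[OF eq, of k] by simp
        next
          case False
          then show ?thesis using W by (auto simp: msgs_def PiE_iff extensional_def)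
        qed
      qed
      show "\<forall>n\<in>set ns. \<psi> n W Q = \<psi> n W' Q"
      proof
        fix n assume "n \<in> set ns"
        then have n: "n \<in> {1..N}" using ns by blast
        have "(\<lambda>n\<in>{1..N}. \<psi> n W Q) n = (\<lambda>n\<in>{1..N}. \<psi> n W' Q) n" using W by auto
        then show "\<psi> n W Q = \<psi> n W' Q" using n by simp
      qed
    qed (use W in auto)
  qed
  moreover have "?R ` ?B \<subseteq> ({1..K} - D) \<rightarrow>\<^sub>E ?V"
  proof (rule image_subsetI)
    fix W assume "W \<in> ?B"
    then have W: "W \<in> msgs F K L" by blast
    show "?R W \<in> ({1..K} - D) \<rightarrow>\<^sub>E ?V"
      unfolding restrict_PiE_iff using msgs_component[OF W] by blast
  qed
  moreover have "finite (({1..K} - D) \<rightarrow>\<^sub>E ?V)"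
    by (intro finite_PiE) (auto simp: finite_vectors[OF finite_carrier])
  ultimately have "card ?B \<le> card (({1..K} - D) \<rightarrow>\<^sub>E ?V)" by (rule card_inj_on_le)
  also have "\<dots> = (q ^ L) ^ (K - length ns)"
  proof -
    have "finite D" using D(1) by (rule finite_subset) simp
    then have "card ({1..K} - D) = K - length ns" using D by (subst card_Diff_subset) auto
    then show ?thesis by (simp add: card_PiE card_vectors[OF finite_carrier])
  qed
  finally have "card ?B * q ^ (length ns * L) \<le> (q ^ L) ^ (K - length ns) * (q ^ L) ^ length ns"
    by (simp add: mult.commute flip: power_mult)
  also have "\<dots> = (q ^ L) ^ K"
    using D card_mono[OF _ D(1)] by (simp flip: power_add)
  finally show ?thesis by (simp add: card_msgs[OF finite_carrier] power_mult)
qed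

lemma rand_size_ge:
  assumes ns: "set ns \<subseteq> {1..N}" "fresh_chain Z {} ns"
  shows "real (length ns) - 1 \<le> rand_size F L P"
proof -
  let ?A = "pmf_of_set (msgs F K L)" and ?X = "\<lambda>(W, Q). (\<lambda>n\<in>{1..N}. \<psi> n W Q)"
  let ?b = "real q"
  have fin: "finite (msgs F K L)" and ne: "msgs F K L \<noteq> {}"
    using finite_msgs[OF finite_carrier] msgs_not_empty[OF zero_closed] by auto
  have b: "1 < ?b" using q_gt_1 by simp
  have finA: "finite (set_pmf ?A)" using fin ne by simp
  have cmi: "cmi ?b (pair_pmf ?A P) fst ?X (\<lambda>z. vsum F K L (fst z)) = 0"
    using scheme_parts[THEN conjunct2, THEN conjunct2, THEN conjunct2, THEN conjunct2, THEN conjunct2]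
    by (simp add: case_prod_unfold)
  have X: "real (length ns * L) \<le> ent ?b (map_pmf ?X (pair_pmf ?A P))"
  proof (rule ent_ge_of_pmf_le[OF _ b])
    show "finite (set_pmf (map_pmf ?X (pair_pmf ?A P)))" using finA finite_P by simp
    fix x
    \<comment> \<open>The transcript law is a mixture over \<open>Q\<close>; the fibre bound holds
      for each fixed \<open>Q\<close>, hence on average.\<close>
    have "map_pmf ?X (pair_pmf ?A P) = bind_pmf P (\<lambda>Q. map_pmf (\<lambda>W. \<lambda>n\<in>{1..N}. \<psi> n W Q) ?A)"
      unfolding pair_pmf_def map_bind_pmf map_pmf_def[of _ ?A] by (subst bind_commute_pmf) (simp add: map_bind_pmf)
    then have "pmf (map_pmf ?X (pair_pmf ?A P)) x
      = measure_pmf.expectation P (\<lambda>Q. pmf (map_pmf (\<lambda>W. \<lambda>n\<in>{1..N}. \<psi> n W Q) ?A) x)"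
      by (simp add: pmf_bind)
    also have "\<dots> \<le> 1 / ?b ^ (length ns * L)"
    proof (rule measure_pmf.integral_le_const)
      show "integrable (measure_pmf P) (\<lambda>Q. pmf (map_pmf (\<lambda>W. \<lambda>n\<in>{1..N}. \<psi> n W Q) ?A) x)"
        by (rule integrable_measure_pmf_finite[OF finite_P])
      show "AE Q in measure_pmf P. pmf (map_pmf (\<lambda>W. \<lambda>n\<in>{1..N}. \<psi> n W Q) ?A) x \<le> 1 / ?b ^ (length ns * L)"
      proof (intro AE_pmfI)
        fix Q assume Q: "Q \<in> set_pmf P"
        let ?B = "{W \<in> msgs F K L. (\<lambda>n\<in>{1..N}. \<psi> n W Q) = x}"
        have "pmf (map_pmf (\<lambda>W. \<lambda>n\<in>{1..N}. \<psi> n W Q) ?A) x = card ?B / card (msgs F K L)"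
          unfolding pmf_map using fin ne
          by (subst measure_pmf_of_set) (auto intro!: arg_cong[of _ _ card] simp: vimage_def)
        also have "\<dots> \<le> 1 / ?b ^ (length ns * L)"
        proof -
          have "real (card ?B * q ^ (length ns * L)) \<le> real (card (msgs F K L))"
            unfolding of_nat_le_iff by (rule card_fibre_le[OF ns Q])
          then have "real (card ?B) * ?b ^ (length ns * L) \<le> real (card (msgs F K L))" by simp
          moreover have "0 < real (card (msgs F K L))" using fin ne by (simp add: card_gt_0_iff)
          moreover have "0 < ?b ^ (length ns * L)" using b by simp
          ultimately show ?thesis by (simp only: pos_divide_le_eq pos_le_divide_eq times_divide_eq_left mult_1)
        qed
        finally show "pmf (map_pmf (\<lambda>W. \<lambda>n\<in>{1..N}. \<psi> n W Q) ?A) x \<le> 1 / ?b ^ (length ns * L)" .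
      qed
    qed
    finally show "pmf (map_pmf ?X (pair_pmf ?A P)) x \<le> 1 / ?b ^ (length ns * L)" .
  qed
  have "ent ?b (map_pmf (vsum F K L) ?A) \<le> log ?b (card {xs. length xs = L \<and> set xs \<subseteq> carrier F})"
    using vsum_in[OF abelian_monoid_axioms] fin ne b
    by (intro ent_le_log_card finite_vectors finite_carrier) auto
  also have "\<dots> = real L" using b by (simp add: card_vectors[OF finite_carrier] log_nat_power)
  finally have "real (length ns * L) - real L \<le> ent ?b P"
    by (rule cmi_zero_imp_ent_ge[OF finA finite_P b cmi X])
  then have "(real (length ns) - 1) * real L \<le> ent ?b P" by (simp add: algebra_simps)
  then show ?thesis using L by (simp add: rand_size_def pos_le_divide_eq)
qed

end

section \<open>Chains of length h and the two bounds combined\<close>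

lemma comm_cost_const:
  assumes "Nr \<le> N" "0 < L"
  shows "comm_cost N Nr L (\<lambda>_. L) = real Nr"
proof -
  obtain A where "A \<subseteq> {1..N}" "card A = Nr"
    using obtain_subset_with_card_n[of Nr "{1..N}"] assms(1) by auto
  then have "{\<Sum>n\<in>A. L | A. A \<subseteq> {1..N} \<and> card A = Nr} = {Nr * L}"
    by (auto intro!: exI[of _ A])
  then show ?thesis using assms(2) by (simp add: comm_cost_def)
qed

text \<open>A covering chain has at least n / m members; rounded up this equals h for m = 1 and for
  residue 1. In the remaining cases h exceeds it by one, and \<open>by_gap\<close> supplies the
  extra member.\<close>

lemma (in uniform_cover) exists_chain_h:
  assumes I: "card I = g * n" and r: "r = g * m" and g: "0 < g"
    and cop: "coprime n m" and m: "0 < m" "m \<le> n" "m \<le> 4"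
  shows "\<exists>xs. set xs \<subseteq> I \<and> fresh_chain Z {} xs \<and> h n m \<le> length xs"
proof -
  have r0: "0 < r" using r g m by simp
  obtain xs where xs: "set xs \<subseteq> I" "fresh_chain Z {} xs" "card I \<le> length xs * r"
    using exists_long_chain[OF r0] by blast
  then have len: "n \<le> length xs * m" using I r g by (simp add: mult.left_commute)
  \<comment> \<open>Without a chain of length h all chains have length at most c = h - 1, so m would
    divide n. For n = (j + 2) m - 1 the gap condition reads (2 j + 3) m < 2 n, that is, m >
    2.\<close>
  have by_gap: ?thesis if gap: "(2 * (h n m - 1) - 1) * m < 2 * n" and nd: "\<not> m dvd n"
  proof (rule ccontr)
    assume neg: "\<not> ?thesis"
    have short: "length xs \<le> h n m - 1" if "set xs \<subseteq> I" "fresh_chain Z {} xs" for xs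
    proof -
      have "\<not> h n m \<le> length xs" using neg that by blast
      then show ?thesis by linarith
    qed
    have "r dvd card I"
    proof (rule dvd_of_short_chains[OF r0])
      show "length xs \<le> h n m - 1" if "set xs \<subseteq> I" "fresh_chain Z {} xs" for xs
        using that by (rule short)
      have "g * ((2 * (h n m - 1) - 1) * m) < g * (2 * n)" by (rule mult_strict_left_mono[OF gap g])
      then show "(2 * (h n m - 1) - 1) * r < 2 * card I" unfolding I r by (simp only: mult_ac)
    qed
    then show False using nd g unfolding I r by simp
  qed
  show ?thesis using cop m(1,2,3)
  proof (cases rule: coprime_small_cases)
    case one
    then show ?thesis using xs len m h_1_right[of n] by auto
  next
    case (succ j)
    have "\<not> length xs \<le> 1 + j"
    proof
      assume "length xs \<le> 1 + j"
      then have "length xs * m \<le> (1 + j) * m" by (rule mult_right_mono) simp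
      then show False using len succ by simp
    qed
    then show ?thesis using xs h_succ_add[of m j] succ m by auto
  next
    case (five j)
    have "\<not> m dvd n" using five by (simp add: dvd_add_left_iff)
    then show ?thesis using five h_five_add[of j] by (intro by_gap) auto
  next
    case (seven j)
    have "\<not> m dvd n" using seven by (simp add: dvd_add_left_iff)
    then show ?thesis using seven h_seven_add[of j] by (intro by_gap) auto
  qed
qed

theorem theorem7:
  fixes K N Nr :: nat
  assumes "0 < K" and "0 < Nr" and "Nr \<le> N" and "N dvd K"
    and "(N - Nr + 1) div gcd N (N - Nr + 1) \<le> 4"
  shows "\<exists>q0::nat. \<forall>(F :: 'a ring) (L :: nat).
           field F \<and> finite (carrier F) \<and> q0 \<le> card (carrier F) \<and> 0 < L \<longrightarrow>
           (\<exists>Z P \<psi> T. comm_optimal_scheme F K N Nr (K div N * (N - Nr + 1)) L Z P \<psi> T \<and>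
                rand_size F L P = real (h N (N - Nr + 1)) - 1) \<and>
           (\<forall>Z P \<psi> T. comm_optimal_scheme F K N Nr (K div N * (N - Nr + 1)) L Z P \<psi> T \<longrightarrow>
                real (h N (N - Nr + 1)) - 1 \<le> rand_size F L P)"
proof (intro exI[of _ 5] allI impI)
  fix F :: "'a ring" and L :: nat
  assume "field F \<and> finite (carrier F) \<and> 5 \<le> card (carrier F) \<and> 0 < L"
  then have F: "field F" and fin: "finite (carrier F)" and q: "5 \<le> card (carrier F)" and L: "0 < L" by auto
  interpret field F by (rule F)
  define M' where "M' = N - Nr + 1"
  define g where "g = gcd N M'"
  define n where "n = N div g"
  define m where "m = M' div g"
  have M': "0 < M'" "M' \<le> N" using assms by (auto simp: M'_def)
  have g: "0 < g" using M' by (simp add: g_def)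
  have N: "N = g * n" unfolding n_def g_def by simp
  have M'g: "M' = g * m" unfolding m_def g_def by simp
  have cop: "coprime n m" unfolding n_def m_def g_def by (rule div_gcd_coprime) (use M' in simp)
  have m: "0 < m" using M'(1) M'g by (cases m) simp_all
  have mn: "m \<le> n" using M'(2) g unfolding N M'g by simp
  have m4: "m \<le> 4" using assms(5) unfolding m_def g_def M'_def .
  have h: "h N M' = h n m" unfolding n_def m_def g_def by (rule h_div_gcd[OF M'])
  define c where "c = K div N"
  have c: "K = c * N" unfolding c_def using assms(4) by simp
  have "Nr = N - M' + 1" using assms(2,3) by (simp add: M'_def)
  then have Nr: "Nr = g * (n - m) + 1" unfolding diff_mult_distrib2 N[symmetric] M'g[symmetric] .
  have KN: "K div N * (N - Nr + 1) = c * (g * m)"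
    unfolding M'_def[symmetric] M'g[symmetric] c_def ..
  \<comment> \<open>An enumeration of the field; its first five values are the points of the
    designs, so the threshold 5 suffices.\<close>
  obtain x where "bij_betw x {0..<card (carrier F)} (carrier F)" using ex_bij_betw_nat_finite[OF fin] by blast
  then have inj: "inj_on x {0..<card (carrier F)}" and im: "x ` {0..<card (carrier F)} = carrier F"
    by (simp_all add: bij_betw_def)
  have x: "x i \<in> carrier F" if "i < 5" for i using im that q by auto
  have x_inj: "inj_on x {..<5}" by (rule inj_on_subset[OF inj]) (use q in auto)
  obtain d u v b where D: "design n m d u v b" and hd: "h n m = d + 1"
    using design_exists[OF x x_inj cop m mn m4] by blast
  interpret S: design_scheme F n m d g c L u v b
    using fin D m mn L by (intro design_scheme.intro design_scheme_axioms.intro F)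
  have scheme: "secure_scheme F K N Nr (K div N * (N - Nr + 1)) L S.Z S.P S.\<psi> (\<lambda>_. L)"
    unfolding KN using S.secure_scheme by (simp only: N c Nr)
  have "comm_optimal_scheme F K N Nr (K div N * (N - Nr + 1)) L S.Z S.P S.\<psi> (\<lambda>_. L)"
    unfolding comm_optimal_scheme_def
  proof (intro conjI scheme allI impI)
    fix Z' P' \<psi>' T' assume "secure_scheme F K N Nr (K div N * (N - Nr + 1)) L Z' P' \<psi>' T'"
    then interpret C: scheme F K N Nr L Z' P' \<psi>' T'
      using fin L assms by (intro scheme.intro scheme_axioms.intro F)
    \<comment> \<open>All transmissions of the constructed scheme have length L, so its cost is Nr,
      and no scheme costs less because each server must send at least L symbols.\<close>
    show "comm_cost N Nr L (\<lambda>_. L) \<le> comm_cost N Nr L T'"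
      using C.comm_cost_ge comm_cost_const[OF assms(3) L] by simp
  qed
  moreover have "rand_size F L S.P = real (h N (N - Nr + 1)) - 1"
    unfolding S.rand_size M'_def[symmetric] h hd by simp
  moreover have "real (h N (N - Nr + 1)) - 1 \<le> rand_size F L P"
    if "comm_optimal_scheme F K N Nr (K div N * (N - Nr + 1)) L Z P \<psi> T" for Z P \<psi> T
  proof -
    interpret C: scheme F K N Nr L Z P \<psi> T
      using that[unfolded comm_optimal_scheme_def, THEN conjunct1] fin L assms
      by (intro scheme.intro scheme_axioms.intro F)
    obtain ns where ns: "set ns \<subseteq> {1..N}" "fresh_chain Z {} ns" "h n m \<le> length ns"
      using C.cover.exists_chain_h[of g n m, OF _ _ g cop m mn m4] N M'g[unfolded M'_def] by auto
    then have "real (h n m) - 1 \<le> real (length ns) - 1" by simp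
    also have "\<dots> \<le> rand_size F L P" by (rule C.rand_size_ge[OF ns(1,2)])
    finally show ?thesis unfolding M'_def[symmetric] h .
  qed
  ultimately show "(\<exists>Z P \<psi> T. comm_optimal_scheme F K N Nr (K div N * (N - Nr + 1)) L Z P \<psi> T \<and>
                rand_size F L P = real (h N (N - Nr + 1)) - 1) \<and>
           (\<forall>Z P \<psi> T. comm_optimal_scheme F K N Nr (K div N * (N - Nr + 1)) L Z P \<psi> T \<longrightarrow>
                real (h N (N - Nr + 1)) - 1 \<le> rand_size F L P)"
    by blast
qed

end
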